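(* Let $\alpha>0$, $\mu,h,\beta\in\mathbb{R}$, $c\in(-1,1)$, and set $\beta^{\pm}:=\beta/(1\pm c)$, $\mu^+:=h-\beta^+/\alpha$, $\mu^-:=-(h-\beta^-/\alpha)$. Consider for $\boldsymbol m=\boldsymbol m(x,t)\in\mathbb{S}^2$, $x\in\mathbb{R}$, the equation $$\partial_t\boldsymbol m=\boldsymbol m\times\Big[\alpha\partial_t\boldsymbol m-\partial_x^2\boldsymbol m+(\mu m_3-h)\boldsymbol{\hat e}_3+\frac{\beta}{1+c\,m_3}\,\boldsymbol m\times\boldsymbol{\hat e}_3\Big].$$ The constant state $\boldsymbol m=\boldsymbol{\hat e}_3$ is (strictly) $L^2$-stable if and only if $\mu<\mu^+$, and the constant state $\boldsymbol m=-\boldsymbol{\hat e}_3$ is (strictly) $L^2$-stable if and only if $\mu<\mu^-$. Instabilities (as $\mu$ increases through $\mu^\pm$) are of Hopf-type for the essential spectrum and have frequency $\beta^\pm/\alpha$ at onset. For $c=0$ the parameters are subsubcritical precisely for $-\mu>|h-\beta/\alpha|$, and supercritical precisely for $\mu>|h-\beta/\alpha|$.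
   Context: Here $\boldsymbol{\hat e}_3=(0,0,1)$. The linearization at $\pm\boldsymbol{\hat e}_3$ is the constant coefficient linear equation for tangential perturbations $\boldsymbol n=(n_1,n_2,0)$ obtained by inserting $\boldsymbol m=\pm\boldsymbol{\hat e}_3+\delta\boldsymbol n+o(\delta)$ at order $\delta$. A constant state is strictly $L^2$-stable if the $L^2(\mathbb{R})$-spectrum of the linearization lies in the open left half plane (bounded away from the imaginary axis). A Hopf-type instability of the essential spectrum with frequency $\varpi$ means that at onset the (purely essential) spectrum touches the imaginary axis at $\pm i\varpi$ (nonzero if $\varpi\ne0$), here with spatially homogeneous critical modes (Fourier wavenumber $\ell=0$). Parameters are called supercritical if $\pm\boldsymbol{\hat e}_3$ are both unstable (the spectrum intersects the open right half plane), subcritical if $\boldsymbol{\hat e}_3$ and $-\boldsymbol{\hat e}_3$ have different stability, and subsubcritical if $\pm\boldsymbol{\hat e}_3$ are both (strictly) stable. *)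

theory Defs
  imports "HOL-Analysis.Analysis"
begin

section \<open>The equation and its linearization\<close>

definition e3 :: "real^3" where
  "e3 = axis 3 1"

text \<open>
  The equation is \<open>llg_residual \<alpha> \<mu> h \<beta> c m (\<partial>\<^sub>t m) (\<partial>\<^sub>x\<^sup>2 m) = 0\<close> at every point \<open>(x, t)\<close>.
\<close>

definition llg_residual ::
  "real \<Rightarrow> real \<Rightarrow> real \<Rightarrow> real \<Rightarrow> real \<Rightarrow> real^3 \<Rightarrow> real^3 \<Rightarrow> real^3 \<Rightarrow> real^3" where
  "llg_residual \<alpha> \<mu> h \<beta> c m mt mxx =
     mt - cross3 m (\<alpha> *\<^sub>R mt - mxx + (\<mu> * m $ 3 - h) *\<^sub>R e3
                    + (\<beta> / (1 + c * m $ 3)) *\<^sub>R cross3 m e3)"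

definition tangential :: "real^2 \<Rightarrow> real^3" where
  "tangential n = vector [n $ 1, n $ 2, 0]"

text \<open>
  The coefficient of \<open>\<delta>\<close> in the residual of \<open>s + \<delta> n + o(\<delta>)\<close> around a constant state \<open>s\<close> is the
  Frechet derivative of the residual at \<open>(s, 0, 0)\<close> in the direction \<open>(n, \<partial>\<^sub>t n, \<partial>\<^sub>x\<^sup>2 n)\<close>;
  the arguments \<open>nt\<close> and \<open>nxx\<close> stand for the last two.
\<close>

definition linearized_eq ::
  "real \<Rightarrow> real \<Rightarrow> real \<Rightarrow> real \<Rightarrow> real \<Rightarrow> real^3 \<Rightarrow> real^2 \<Rightarrow> real^2 \<Rightarrow> real^2 \<Rightarrow> bool" where
  "linearized_eq \<alpha> \<mu> h \<beta> c s n nt nxx \<longleftrightarrow>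
     frechet_derivative (\<lambda>(m, mt, mxx). llg_residual \<alpha> \<mu> h \<beta> c m mt mxx) (at (s, 0, 0))
       (tangential n, tangential nt, tangential nxx) = 0"

text \<open>Complexification, needed for spectra: real and imaginary parts satisfy the real equation.\<close>

definition linearized_eq_complex ::
  "real \<Rightarrow> real \<Rightarrow> real \<Rightarrow> real \<Rightarrow> real \<Rightarrow> real^3 \<Rightarrow> complex^2 \<Rightarrow> complex^2 \<Rightarrow> complex^2 \<Rightarrow> bool" where
  "linearized_eq_complex \<alpha> \<mu> h \<beta> c s n nt nxx \<longleftrightarrow>
     linearized_eq \<alpha> \<mu> h \<beta> c s (\<chi> i. Re (n $ i)) (\<chi> i. Re (nt $ i)) (\<chi> i. Re (nxx $ i)) \<and>
     linearized_eq \<alpha> \<mu> h \<beta> c s (\<chi> i. Im (n $ i)) (\<chi> i. Im (nt $ i)) (\<chi> i. Im (nxx $ i))"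


section \<open>Spectra of operators on the square-integrable functions\<close>

text \<open>
  Elements of \<open>L\<^sup>2(\<real>; \<complex>\<^sup>2)\<close> are represented by functions; identities between them are required
  almost everywhere.
\<close>

type_synonym profile = "real \<Rightarrow> complex^2"

definition L2 :: "profile set" where
  "L2 = {f \<in> borel_measurable borel. integrable lborel (\<lambda>x. (norm (f x))\<^sup>2)}"

definition L2_norm :: "profile \<Rightarrow> real" where
  "L2_norm f = sqrt (LINT x|lborel. (norm (f x))\<^sup>2)"

definition L2_null :: "profile set" where
  "L2_null = {f \<in> L2. AE x in lborel. f x = 0}"

text \<open>
  \<open>u\<close> lies in the Sobolev space \<open>H\<^sup>2(\<real>; \<complex>\<^sup>2)\<close> with derivatives \<open>u'\<close> and \<open>u''\<close>: one-dimensional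
  Sobolev functions are the locally absolutely continuous ones with derivatives in \<open>L\<^sup>2\<close>.
\<close>

definition H2_derivs :: "profile \<Rightarrow> profile \<Rightarrow> profile \<Rightarrow> bool" where
  "H2_derivs u u' u'' \<longleftrightarrow> u \<in> L2 \<and> u' \<in> L2 \<and> u'' \<in> L2 \<and>
     (\<forall>a b. a \<le> b \<longrightarrow> u b - u a = (LINT x:{a..b}|lborel. u' x)) \<and>
     (\<forall>a b. a \<le> b \<longrightarrow> u' b - u' a = (LINT x:{a..b}|lborel. u'' x))"

text \<open>
  An unbounded operator is given by its graph. \<open>shifted_eq T z u f\<close> says that \<open>u\<close> is in the domain
  of \<open>T\<close> and \<open>(T - z) u = f\<close>.
\<close>

type_synonym operator = "(profile \<times> profile) set"

definition shifted_eq :: "operator \<Rightarrow> complex \<Rightarrow> profile \<Rightarrow> profile \<Rightarrow> bool" where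
  "shifted_eq T z u f \<longleftrightarrow> (\<exists>g. (u, g) \<in> T \<and> (AE x in lborel. g x - z *s u x = f x))"

definition resolvent_set :: "operator \<Rightarrow> complex set" where
  "resolvent_set T = {z.
     (\<forall>f\<in>L2. \<exists>u. shifted_eq T z u f) \<and>
     (\<forall>u. shifted_eq T z u (\<lambda>_. 0) \<longrightarrow> (AE x in lborel. u x = 0)) \<and>
     (\<exists>C. \<forall>f\<in>L2. \<forall>u. shifted_eq T z u f \<longrightarrow> L2_norm u \<le> C * L2_norm f)}"

definition spectrum :: "operator \<Rightarrow> complex set" where
  "spectrum T = - resolvent_set T"

definition shifted_kernel :: "operator \<Rightarrow> complex \<Rightarrow> profile set" where
  "shifted_kernel T z = {u. shifted_eq T z u (\<lambda>_. 0)}"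

definition shifted_range :: "operator \<Rightarrow> complex \<Rightarrow> profile set" where
  "shifted_range T z = {f \<in> L2. \<exists>u. shifted_eq T z u f}"

text \<open>
  The complex vector space \<open>V / W\<close> has dimension \<open>k\<close>: the classes of \<open>e 0, \<dots>, e (k - 1)\<close>
  form a basis.
\<close>

definition has_quotient_dim :: "profile set \<Rightarrow> profile set \<Rightarrow> nat \<Rightarrow> bool" where
  "has_quotient_dim V W k \<longleftrightarrow>
     (\<exists>e :: nat \<Rightarrow> profile. (\<forall>i<k. e i \<in> V) \<and>
        (\<forall>v\<in>V. \<exists>!a :: nat \<Rightarrow> complex. (\<forall>i\<ge>k. a i = 0) \<and>
            (\<lambda>x. v x - (\<Sum>i<k. a i *s e i x)) \<in> W))"

definition closed_in_L2 :: "profile set \<Rightarrow> bool" where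
  "closed_in_L2 R \<longleftrightarrow>
     (\<forall>F. \<forall>f\<in>L2. (\<forall>n::nat. F n \<in> R) \<and> (\<lambda>n. L2_norm (\<lambda>x. F n x - f x)) \<longlonglongrightarrow> 0 \<longrightarrow> f \<in> R)"

definition fredholm_index_zero :: "operator \<Rightarrow> complex \<Rightarrow> bool" where
  "fredholm_index_zero T z \<longleftrightarrow> closed_in_L2 (shifted_range T z) \<and>
     (\<exists>k. has_quotient_dim (shifted_kernel T z) L2_null k \<and>
          has_quotient_dim L2 (shifted_range T z) k)"

text \<open>
  Convention: the complement of the essential spectrum in the spectrum is the point spectrum,
  where \<open>T - z\<close> is Fredholm of index zero but not invertible.
\<close>

definition essential_spectrum :: "operator \<Rightarrow> complex set" where
  "essential_spectrum T = {z. \<not> fredholm_index_zero T z}"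


section \<open>Stability of constant states\<close>

text \<open>\<open>(u, g) \<in> linearization \<dots> s\<close> means that \<open>\<partial>\<^sub>t u = g\<close> is the linearized equation for \<open>u\<close>.\<close>

definition linearization ::
  "real \<Rightarrow> real \<Rightarrow> real \<Rightarrow> real \<Rightarrow> real \<Rightarrow> real^3 \<Rightarrow> operator" where
  "linearization \<alpha> \<mu> h \<beta> c s = {(u, g). g \<in> L2 \<and>
     (\<exists>u' u''. H2_derivs u u' u'' \<and>
        (AE x in lborel. linearized_eq_complex \<alpha> \<mu> h \<beta> c s (u x) (g x) (u'' x)))}"

definition strictly_stable ::
  "real \<Rightarrow> real \<Rightarrow> real \<Rightarrow> real \<Rightarrow> real \<Rightarrow> real^3 \<Rightarrow> bool" where
  "strictly_stable \<alpha> \<mu> h \<beta> c s \<longleftrightarrow>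
     (\<exists>\<epsilon>>0. \<forall>z\<in>spectrum (linearization \<alpha> \<mu> h \<beta> c s). Re z \<le> - \<epsilon>)"

definition unstable ::
  "real \<Rightarrow> real \<Rightarrow> real \<Rightarrow> real \<Rightarrow> real \<Rightarrow> real^3 \<Rightarrow> bool" where
  "unstable \<alpha> \<mu> h \<beta> c s \<longleftrightarrow> (\<exists>z\<in>spectrum (linearization \<alpha> \<mu> h \<beta> c s). Re z > 0)"

text \<open>
  \<open>e\<^bsup>z t + i l x\<^esup> v\<close> solves the linearized equation at \<open>s\<close> for some \<open>v \<noteq> 0\<close>.
\<close>

definition fourier_mode ::
  "real \<Rightarrow> real \<Rightarrow> real \<Rightarrow> real \<Rightarrow> real \<Rightarrow> real^3 \<Rightarrow> complex \<Rightarrow> real \<Rightarrow> bool" where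
  "fourier_mode \<alpha> \<mu> h \<beta> c s z l \<longleftrightarrow>
     (\<exists>v :: complex^2. v \<noteq> 0 \<and>
        (let u = (\<lambda>x. cis (l * x) *s v);
             u' = (\<lambda>x. vector_derivative u (at x));
             u'' = (\<lambda>x. vector_derivative u' (at x))
         in \<forall>x. linearized_eq_complex \<alpha> \<mu> h \<beta> c s (u x) (z *s u x) (u'' x)))"

text \<open>
  As \<open>\<mu>\<close> increases through \<open>\<mu>0\<close>, the state \<open>s\<close> loses stability; at \<open>\<mu> = \<mu>0\<close> the spectrum is purely
  essential, touches the imaginary axis from the left exactly at \<open>\<plusminus>i \<omega>\<close>, and the critical modes have
  wavenumber zero.
\<close>

definition hopf_type_instability ::
  "real \<Rightarrow> real \<Rightarrow> real \<Rightarrow> real \<Rightarrow> real^3 \<Rightarrow> real \<Rightarrow> real \<Rightarrow> bool" where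
  "hopf_type_instability \<alpha> h \<beta> c s \<mu>0 \<omega> \<longleftrightarrow>
     (\<forall>\<mu><\<mu>0. strictly_stable \<alpha> \<mu> h \<beta> c s) \<and>
     (\<forall>\<mu>>\<mu>0. unstable \<alpha> \<mu> h \<beta> c s) \<and>
     (\<forall>z\<in>spectrum (linearization \<alpha> \<mu>0 h \<beta> c s). Re z \<le> 0) \<and>
     spectrum (linearization \<alpha> \<mu>0 h \<beta> c s) \<inter> {z. Re z = 0} = {\<i> * \<omega>, - \<i> * \<omega>} \<and>
     essential_spectrum (linearization \<alpha> \<mu>0 h \<beta> c s) = spectrum (linearization \<alpha> \<mu>0 h \<beta> c s) \<and>
     {(z, l). Re z = 0 \<and> fourier_mode \<alpha> \<mu>0 h \<beta> c s z l} = {(\<i> * \<omega>, 0), (- \<i> * \<omega>, 0)}"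

definition supercritical :: "real \<Rightarrow> real \<Rightarrow> real \<Rightarrow> real \<Rightarrow> real \<Rightarrow> bool" where
  "supercritical \<alpha> \<mu> h \<beta> c \<longleftrightarrow> unstable \<alpha> \<mu> h \<beta> c e3 \<and> unstable \<alpha> \<mu> h \<beta> c (- e3)"

definition subsubcritical :: "real \<Rightarrow> real \<Rightarrow> real \<Rightarrow> real \<Rightarrow> real \<Rightarrow> bool" where
  "subsubcritical \<alpha> \<mu> h \<beta> c \<longleftrightarrow>
     strictly_stable \<alpha> \<mu> h \<beta> c e3 \<and> strictly_stable \<alpha> \<mu> h \<beta> c (- e3)"

definition beta_plus :: "real \<Rightarrow> real \<Rightarrow> real" where
  "beta_plus \<beta> c = \<beta> / (1 + c)"

definition beta_minus :: "real \<Rightarrow> real \<Rightarrow> real" where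
  "beta_minus \<beta> c = \<beta> / (1 - c)"

definition mu_plus :: "real \<Rightarrow> real \<Rightarrow> real \<Rightarrow> real \<Rightarrow> real" where
  "mu_plus \<alpha> h \<beta> c = h - beta_plus \<beta> c / \<alpha>"

definition mu_minus :: "real \<Rightarrow> real \<Rightarrow> real \<Rightarrow> real \<Rightarrow> real" where
  "mu_minus \<alpha> h \<beta> c = - (h - beta_minus \<beta> c / \<alpha>)"

end

theory Submission
  imports Defs
begin

text \<open>
  Linearizing at \<open>\<sigma> e\<^sub>3\<close> with \<open>\<sigma> = \<plusminus>1\<close> gives a constant coefficient system for the two tangential
  components, built from the identity and the rotation by a right angle. The combinations
  \<open>n\<^sub>1 + i \<kappa> \<sigma> n\<^sub>2\<close>, \<open>\<kappa> = \<plusminus>1\<close>, diagonalize that rotation, so the equation \<open>(T - z) u = f\<close> splits into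
  two scalar equations \<open>p'' = K p + (\<alpha> + i \<kappa>) f\<^sub>\<kappa>\<close> on the line, where
  \<open>K = (\<alpha> + i \<kappa>) z - i \<kappa> B - d\<close> with \<open>B = \<sigma> \<beta> / (1 + c \<sigma>)\<close> and \<open>d = \<mu> - \<sigma> h\<close>. The operator \<open>\<partial>\<^sub>x\<^sup>2\<close> on
  \<open>L\<^sup>2\<close> has spectrum \<open>(-\<infinity>, 0]\<close>; hence \<open>z\<close> is in the spectrum of the linearization iff \<open>K = - l\<^sup>2\<close> for
  some \<open>\<kappa>\<close> and some real \<open>l\<close>. Solving for \<open>z\<close> gives two half-lines, exchanged by complex conjugation, with
  \<open>Re z = (\<alpha> (d - l\<^sup>2) + B) / (1 + \<alpha>\<^sup>2)\<close>, maximal at \<open>l = 0\<close>. Thus stability is decided by the sign of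
  \<open>\<alpha> d + B\<close>, and where this vanishes the tips of the half-lines sit at \<open>\<plusminus> i B / \<alpha>\<close>.

  The spectrum of \<open>\<partial>\<^sub>x\<^sup>2\<close> is determined without the Fourier transform, by writing \<open>K = k\<^sup>2\<close> and
  factoring \<open>\<partial>\<^sub>x\<^sup>2 - k\<^sup>2 = (\<partial>\<^sub>x + k) (\<partial>\<^sub>x - k)\<close>. The first-order factors are handled with the
  integrating factor \<open>e\<^bsup>k x\<^esup>\<close>: they are injective on \<open>L\<^sup>2\<close> for every \<open>k\<close>
  (\<open>first_order_kernel_trivial\<close>), boundedly invertible by convolution with a decaying exponential if
  \<open>Re k \<noteq> 0\<close> (\<open>first_order_solvable\<close>), and not onto if \<open>Re k = 0\<close>
  (\<open>resonant_forcing_unsolvable\<close>).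

  Since the kernel of \<open>T - z\<close> is trivial for every \<open>z\<close>, being Fredholm of index zero is the same as being
  onto. So the essential spectrum is the whole spectrum, at every value of the parameters
  (\<open>spectrum_linearization\<close>).
\<close>

section \<open>Square-integrable functions\<close>

definition square_integrable :: "(real \<Rightarrow> 'a::{real_normed_vector,second_countable_topology}) \<Rightarrow> bool" where
  "square_integrable f \<longleftrightarrow> f \<in> borel_measurable borel \<and> integrable lborel (\<lambda>x. (norm (f x))\<^sup>2)"

definition L2_sq :: "(real \<Rightarrow> 'a::{real_normed_vector,second_countable_topology}) \<Rightarrow> real" where
  "L2_sq f = (LINT x|lborel. (norm (f x))\<^sup>2)"

lemma square_integrable_measurable [measurable_dest]:
  "square_integrable f \<Longrightarrow> f \<in> borel_measurable borel"
  by (simp add: square_integrable_def)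

lemma square_integrable_dominated:
  assumes f: "square_integrable f" and m [measurable]: "g \<in> borel_measurable borel"
    and le: "\<And>x. norm (g x) \<le> C * norm (f x)"
  shows "square_integrable g" "L2_sq g \<le> C\<^sup>2 * L2_sq f"
proof -
  have le2: "(norm (g x))\<^sup>2 \<le> C\<^sup>2 * (norm (f x))\<^sup>2" for x
    using power_mono[OF le[of x], of 2] by (simp add: power_mult_distrib)
  have i: "integrable lborel (\<lambda>x. C\<^sup>2 * (norm (f x))\<^sup>2)"
    using f by (simp add: square_integrable_def)
  have ig: "integrable lborel (\<lambda>x. (norm (g x))\<^sup>2)"
    by (rule Bochner_Integration.integrable_bound[OF i]) (use le2 in \<open>auto simp: abs_mult\<close>)
  show "square_integrable g" using ig m by (simp add: square_integrable_def)
  have "L2_sq g \<le> (LINT x|lborel. C\<^sup>2 * (norm (f x))\<^sup>2)"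
    unfolding L2_sq_def by (rule integral_mono[OF ig i le2])
  then show "L2_sq g \<le> C\<^sup>2 * L2_sq f" by (simp add: L2_sq_def)
qed

lemma square_integrable_add:
  assumes f: "square_integrable f" and g: "square_integrable g"
  shows "square_integrable (\<lambda>x. f x + g x)" "L2_sq (\<lambda>x. f x + g x) \<le> 2 * L2_sq f + 2 * L2_sq g"
proof -
  note [measurable] = square_integrable_measurable[OF f] square_integrable_measurable[OF g]
  have le: "(norm (f x + g x))\<^sup>2 \<le> 2 * (norm (f x))\<^sup>2 + 2 * (norm (g x))\<^sup>2" for x
  proof -
    have "(norm (f x + g x))\<^sup>2 \<le> (norm (f x) + norm (g x))\<^sup>2"
      by (intro power_mono norm_triangle_ineq) auto
    also have "\<dots> \<le> 2 * (norm (f x))\<^sup>2 + 2 * (norm (g x))\<^sup>2"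
      using sum_squares_ge_zero[of "norm (f x) - norm (g x)" 0] by (simp add: power2_eq_square algebra_simps)
    finally show ?thesis .
  qed
  have i: "integrable lborel (\<lambda>x. 2 * (norm (f x))\<^sup>2 + 2 * (norm (g x))\<^sup>2)"
    using f g by (simp add: square_integrable_def)
  have ig: "integrable lborel (\<lambda>x. (norm (f x + g x))\<^sup>2)"
    by (rule Bochner_Integration.integrable_bound[OF i]) (use le in auto)
  show "square_integrable (\<lambda>x. f x + g x)" using ig by (simp add: square_integrable_def)
  have "L2_sq (\<lambda>x. f x + g x) \<le> (LINT x|lborel. 2 * (norm (f x))\<^sup>2 + 2 * (norm (g x))\<^sup>2)"
    unfolding L2_sq_def by (rule integral_mono[OF ig i le])
  also have "\<dots> = 2 * L2_sq f + 2 * L2_sq g"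
    using f g by (simp add: square_integrable_def L2_sq_def)
  finally show "L2_sq (\<lambda>x. f x + g x) \<le> 2 * L2_sq f + 2 * L2_sq g" .
qed

lemma square_integrable_bounded_linear:
  assumes f: "square_integrable f" and T: "bounded_linear T"
  shows "square_integrable (\<lambda>x. T (f x))" "L2_sq (\<lambda>x. T (f x)) \<le> (onorm T)\<^sup>2 * L2_sq f"
proof -
  have [measurable]: "T \<in> borel_measurable borel"
    using T by (intro borel_measurable_continuous_onI) (simp add: linear_continuous_on)
  note [measurable] = square_integrable_measurable[OF f]
  have m: "(\<lambda>x. T (f x)) \<in> borel_measurable borel" by measurable
  show "square_integrable (\<lambda>x. T (f x))" "L2_sq (\<lambda>x. T (f x)) \<le> (onorm T)\<^sup>2 * L2_sq f"
    using square_integrable_dominated[OF f m onorm[OF T]] by blast+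
qed

lemma square_integrable_cmult:
  fixes f :: "real \<Rightarrow> complex"
  shows "square_integrable f \<Longrightarrow> square_integrable (\<lambda>x. c * f x)"
  using square_integrable_bounded_linear(1)[OF _ bounded_linear_mult_right] .

lemma square_integrable_AE_cong:
  assumes "AE x in lborel. f x = g x" "f \<in> borel_measurable borel" "g \<in> borel_measurable borel"
  shows "L2_sq f = L2_sq g" "square_integrable f = square_integrable g"
proof -
  note [measurable] = assms(2,3)
  show "L2_sq f = L2_sq g" unfolding L2_sq_def
    by (rule integral_cong_AE) (use assms(1) in auto)
  have "integrable lborel (\<lambda>x. (norm (f x))\<^sup>2) = integrable lborel (\<lambda>x. (norm (g x))\<^sup>2)"
    by (rule integrable_cong_AE) (use assms(1) in auto)
  then show "square_integrable f = square_integrable g"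
    using assms by (simp add: square_integrable_def)
qed

lemma le_one_plus_square: "t \<le> 1 + t\<^sup>2" for t :: real
  using sum_squares_ge_zero[of "t - 1/2" 0] by (simp add: power2_eq_square algebra_simps)

lemma square_integrable_set_integrable:
  fixes f :: "real \<Rightarrow> 'a::{banach,second_countable_topology}"
  assumes f: "square_integrable f"
  shows "set_integrable lborel {a..b} f"
proof -
  note [measurable] = square_integrable_measurable[OF f]
  have i: "integrable lborel (\<lambda>x. indicator {a..b} x + (norm (f x))\<^sup>2 :: real)"
    using f by (intro Bochner_Integration.integrable_add)
      (auto simp: square_integrable_def emeasure_lborel_Icc_eq)
  show ?thesis unfolding set_integrable_def
    by (rule Bochner_Integration.integrable_bound[OF i])
      (use le_one_plus_square in \<open>auto simp: indicator_def\<close>)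
qed

text \<open>
  The uniqueness and the non-existence arguments below all reach their contradiction here, with a
  half-line for \<open>S\<close>.
\<close>

lemma square_integrable_not_bounded_below:
  assumes f: "square_integrable f" and S: "S \<in> sets borel" "emeasure lborel S = \<infinity>"
    and m: "m > 0" "\<And>x. x \<in> S \<Longrightarrow> m \<le> norm (f x)"
  shows False
proof -
  have i: "integrable lborel (\<lambda>x. (norm (f x))\<^sup>2 / m\<^sup>2)"
    using f by (simp add: square_integrable_def)
  have "1 \<le> (norm (f x))\<^sup>2 / m\<^sup>2" if "x \<in> S" for x
    using power_mono[OF m(2)[OF that], of 2] m(1) by simp
  then have "integrable lborel (indicator S :: real \<Rightarrow> real)"
    using S by (intro Bochner_Integration.integrable_bound[OF i]) (auto simp: indicator_def)
  then show False using S by (simp add: integrable_indicator_iff)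
qed

lemma emeasure_lborel_half_lines:
  "emeasure lborel {a::real..} = \<infinity>" "emeasure lborel {..a::real} = \<infinity>"
proof -
  have big: "x = \<infinity>" if "\<And>n::nat. ennreal n \<le> x" for x :: ennreal
  proof (rule ccontr)
    assume "x \<noteq> \<infinity>"
    then obtain r where r: "x = ennreal r" "0 \<le> r" by (cases x) auto
    obtain n :: nat where "r < n" using reals_Archimedean2 by blast
    then show False using that[of n] r by (simp add: ennreal_le_iff)
  qed
  show "emeasure lborel {a..} = \<infinity>"
  proof (rule big)
    fix n :: nat
    have "emeasure lborel {a..a+n} \<le> emeasure lborel {a..}" by (rule emeasure_mono) auto
    then show "ennreal n \<le> emeasure lborel {a..}" by (simp add: emeasure_lborel_Icc_eq)
  qed
  show "emeasure lborel {..a} = \<infinity>"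
  proof (rule big)
    fix n :: nat
    have "emeasure lborel {a-n..a} \<le> emeasure lborel {..a}" by (rule emeasure_mono) auto
    then show "ennreal n \<le> emeasure lborel {..a}" by (simp add: emeasure_lborel_Icc_eq)
  qed
qed

section \<open>First-order equations on the line\<close>

text \<open>
  Local absolute continuity with a given derivative, in the integral form in which \<open>H2_derivs\<close>
  expresses it.
\<close>

definition is_primitive :: "(real \<Rightarrow> complex) \<Rightarrow> (real \<Rightarrow> complex) \<Rightarrow> bool" where
  "is_primitive u u' \<longleftrightarrow> u \<in> borel_measurable borel \<and> u' \<in> borel_measurable borel \<and>
     (\<forall>a b. a \<le> b \<longrightarrow> set_integrable lborel {a..b} u' \<and> u b - u a = (LINT x:{a..b}|lborel. u' x))"

text \<open>
  The product rule for an integrating factor. As \<open>u'\<close> is a derivative only almost everywhere, the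
  fundamental theorem of calculus does not apply to the product. Instead, \<open>u x - u a\<close> is written as the
  integral of \<open>u'\<close> over \<open>{a..x}\<close>, and the double integral of \<open>k e\<^bsup>k x\<^esup> u' y\<close> over the triangle
  \<open>a \<le> y \<le> x \<le> b\<close> is evaluated in both orders.
\<close>

lemma is_primitive_exp_mult:
  fixes u u' :: "real \<Rightarrow> complex" and k :: complex
  assumes p: "is_primitive u u'"
  shows "is_primitive (\<lambda>x::real. exp (k * x) * u x) (\<lambda>x. exp (k * x) * (u' x + k * u x))"
proof -
  have [measurable]: "u \<in> borel_measurable borel" "u' \<in> borel_measurable borel"
    and int: "\<And>a b. a \<le> b \<Longrightarrow> set_integrable lborel {a..b} u'"
    and diff: "\<And>a b. a \<le> b \<Longrightarrow> u b - u a = (LINT x:{a..b}|lborel. u' x)"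
    using p by (auto simp: is_primitive_def)
  define E :: "real \<Rightarrow> complex" where "E x = exp (k * x)" for x
  have contE: "continuous_on A E" for A unfolding E_def by (intro continuous_intros)
  have [measurable]: "E \<in> borel_measurable borel"
    by (rule borel_measurable_continuous_onI[OF contE])
  have dE: "(E has_vector_derivative (k * E x)) (at x within A)" for x A
    unfolding E_def by (rule has_vector_derivative_real_field) (auto intro!: derivative_eq_intros)
  have bE: "\<exists>M. \<forall>x\<in>{a..b}. norm (E x) \<le> M" for a b :: real
    using compact_imp_bounded[OF compact_continuous_image[OF contE compact_Icc]]
    by (auto simp: bounded_iff)
  have setE: "set_integrable lborel {a..b} (\<lambda>x. E x * f x)" if f: "set_integrable lborel {a..b} f" 
    and [measurable]: "f \<in> borel_measurable borel" for f :: "real \<Rightarrow> complex" and a b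
  proof -
    obtain M where M: "\<forall>x\<in>{a..b}. norm (E x) \<le> M" using bE by blast
    have "integrable lborel (\<lambda>x. M *\<^sub>R (indicator {a..b} x *\<^sub>R f x))"
      using f unfolding set_integrable_def by (rule integrable_scaleR_right)
    then show ?thesis unfolding set_integrable_def
      by (rule Bochner_Integration.integrable_bound)
        (use M in \<open>auto simp: indicator_def norm_mult intro!: mult_right_mono order_trans[OF _ abs_ge_self]\<close>)
  qed
  have main: "set_integrable lborel {a..b} (\<lambda>x. E x * (u' x + k * u x)) \<and>
     E b * u b - E a * u a = (LINT x:{a..b}|lborel. E x * (u' x + k * u x))" if ab: "a \<le> b" for a b
  proof -
    \<comment> \<open>the integrand on the triangle, extended by zero\<close>
    define f where "f x y = (if a \<le> y \<and> y \<le> x \<and> x \<le> b then k * E x * u' y else 0)" for x y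
    obtain M where M: "\<forall>x\<in>{a..b}. norm (E x) \<le> M" using bE by blast
    have intf: "integrable (lborel \<Otimes>\<^sub>M lborel) (case_prod f)"
    proof -
      have "integrable (lborel \<Otimes>\<^sub>M lborel) (\<lambda>(x,y). (norm k * M * indicator {a..b} x) *\<^sub>R (indicator {a..b} y *\<^sub>R norm (u' y)))"
      proof (rule lborel_pair.Fubini_integrable)
        have i: "integrable lborel (\<lambda>y. indicator {a..b} y *\<^sub>R norm (u' y))"
          using integrable_norm[OF int[OF ab, unfolded set_integrable_def]] by simp
        show "AE x in lborel. integrable lborel (\<lambda>y. case (x, y) of (x, y) \<Rightarrow>
            (norm k * M * indicator {a..b} x) *\<^sub>R (indicator {a..b} y *\<^sub>R norm (u' y)))"
          using i by auto
        have "integrable lborel (\<lambda>x. \<bar>norm k * M\<bar> * (LINT y|lborel. indicator {a..b} y *\<^sub>R norm (u' y)) * indicator {a..b} x)"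
          by (simp add: emeasure_lborel_Icc_eq)
        moreover have "(LINT y|lborel. norm (case (x, y) of (x, y) \<Rightarrow>
            (norm k * M * indicator {a..b} x) *\<^sub>R (indicator {a..b} y *\<^sub>R norm (u' y))))
            = \<bar>norm k * M\<bar> * (LINT y|lborel. indicator {a..b} y *\<^sub>R norm (u' y)) * indicator {a..b} x" for x
          by (cases "x \<in> {a..b}") (auto simp: abs_mult)
        ultimately show "integrable lborel (\<lambda>x. LINT y|lborel. norm (case (x, y) of (x, y) \<Rightarrow>
            (norm k * M * indicator {a..b} x) *\<^sub>R (indicator {a..b} y *\<^sub>R norm (u' y))))"
          by simp
      qed simp
      then show ?thesis
      proof (rule Bochner_Integration.integrable_bound)
        show "case_prod f \<in> borel_measurable (lborel \<Otimes>\<^sub>M lborel)"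
          unfolding f_def by measurable
      next
        show "AE x in lborel \<Otimes>\<^sub>M lborel. norm (case x of (x, y) \<Rightarrow> f x y) \<le>
          norm (case x of (x, y) \<Rightarrow> (norm k * M * indicator {a..b} x) *\<^sub>R (indicator {a..b} y *\<^sub>R norm (u' y)))"
        proof (rule AE_I2, clarify)
          fix x y
          show "norm (f x y) \<le> norm ((norm k * M * indicator {a..b} x) *\<^sub>R (indicator {a..b} y *\<^sub>R norm (u' y)))"
          proof (cases "a \<le> y \<and> y \<le> x \<and> x \<le> b")
            case True
            then have "norm (E x) \<le> M" using M by auto
            then have "norm k * norm (E x) * norm (u' y) \<le> norm k * M * norm (u' y)"
              by (intro mult_right_mono mult_left_mono) auto
            then show ?thesis using True order_trans[OF _ abs_ge_self]
              by (simp add: f_def norm_mult)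
          qed (auto simp: f_def)
        qed
      qed
    qed
    have 1: "(LINT y|lborel. f x y) = indicator {a..b} x *\<^sub>R (k * E x * (u x - u a))" for x
    proof (cases "x \<in> {a..b}")
      case True
      then have "(LINT y|lborel. f x y) = (LINT y:{a..x}|lborel. k * E x * u' y)"
        unfolding set_lebesgue_integral_def by (intro Bochner_Integration.integral_cong) (auto simp: f_def indicator_def)
      also have "\<dots> = k * E x * (u x - u a)" using True diff[of a x] by simp
      finally show ?thesis using True by simp
    next
      case False then have "f x y = 0" for y by (auto simp: f_def)
      then show ?thesis using False by simp
    qed
    have 2: "(LINT x|lborel. f x y) = indicator {a..b} y *\<^sub>R ((E b - E y) * u' y)" for y
    proof (cases "y \<in> {a..b}")
      case True
      then have "(LINT x|lborel. f x y) = (LINT x:{y..b}|lborel. k * E x * u' y)"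
        unfolding set_lebesgue_integral_def by (intro Bochner_Integration.integral_cong) (auto simp: f_def indicator_def)
      also have "\<dots> = (LINT x:{y..b}|lborel. k * E x) * u' y" by simp
      also have "(LINT x:{y..b}|lborel. k * E x) = E b - E y" 
        unfolding set_lebesgue_integral_def
        using True by (intro integral_FTC_Icc dE continuous_intros contE) auto
      finally show ?thesis using True by simp
    next
      case False then have "f x y = 0" for x by (auto simp: f_def)
      then show ?thesis using False by simp
    qed
    have swap: "(LINT x:{a..b}|lborel. k * E x * (u x - u a)) = (LINT y:{a..b}|lborel. (E b - E y) * u' y)"
      using lborel_pair.Fubini_integral[OF intf] unfolding 1 2 set_lebesgue_integral_def by simp
    have i1: "set_integrable lborel {a..b} (\<lambda>x. k * E x * (u x - u a))"
      using lborel_pair.integrable_fst'[OF intf] by (simp add: 1 set_integrable_def)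
    have c: "set_integrable lborel {a..b} (\<lambda>x. c)" for c :: complex
      by (simp add: set_integrable_def emeasure_lborel_Icc_eq)
    have i2: "set_integrable lborel {a..b} (\<lambda>x. E x * u' x)"
      by (rule setE[OF int[OF ab]]) simp
    have i3: "set_integrable lborel {a..b} (\<lambda>x. k * E x)"
      using setE[OF c[of k]] by (simp add: mult.commute)
    have i4: "set_integrable lborel {a..b} (\<lambda>x. k * E x * (u x - u a) + k * E x * u a)"
      using i1 i3 by (intro set_integral_add) auto
    have i5: "set_integrable lborel {a..b} (\<lambda>x. k * E x * u x)"
      using i4 by (simp add: algebra_simps)
    have e1: "(LINT x:{a..b}|lborel. k * E x) = E b - E a" 
        unfolding set_lebesgue_integral_def
        using ab by (intro integral_FTC_Icc dE continuous_intros contE) auto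
    have "(LINT x:{a..b}|lborel. k * E x * u x) = (LINT x:{a..b}|lborel. k * E x * (u x - u a) + k * E x * u a)"
      by (simp add: algebra_simps)
    also have "\<dots> = (LINT x:{a..b}|lborel. k * E x * (u x - u a)) + (LINT x:{a..b}|lborel. k * E x * u a)"
      using i1 i3 by (intro set_integral_add) auto
    also have "\<dots> = (LINT y:{a..b}|lborel. E b * u' y - E y * u' y) + (E b - E a) * u a"
      unfolding swap set_integral_mult_left e1 by (simp add: algebra_simps)
    also have "(LINT y:{a..b}|lborel. E b * u' y - E y * u' y) = (LINT y:{a..b}|lborel. E b * u' y) - (LINT y:{a..b}|lborel. E y * u' y)"
      using int[OF ab] i2 by (intro set_integral_diff) auto
    also have "(LINT y:{a..b}|lborel. E b * u' y) = E b * (u b - u a)" using diff[OF ab] by simp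
    finally have "(LINT x:{a..b}|lborel. E x * u' x) + (LINT x:{a..b}|lborel. k * E x * u x) = E b * u b - E a * u a"
      by (simp add: algebra_simps)
    moreover have "(LINT x:{a..b}|lborel. E x * u' x + k * E x * u x) = (LINT x:{a..b}|lborel. E x * u' x) + (LINT x:{a..b}|lborel. k * E x * u x)"
      "set_integrable lborel {a..b} (\<lambda>x. E x * u' x + k * E x * u x)"
      using i2 i5 by (intro set_integral_add; simp)+
    ultimately show ?thesis by (simp add: algebra_simps)
  qed
  then show ?thesis unfolding is_primitive_def E_def[symmetric] by simp
qed

text \<open>
  \<open>u\<close> lies in the Sobolev space \<open>H\<^sup>1(\<real>; \<complex>)\<close> with weak derivative \<open>u'\<close>.
\<close>

definition H1_deriv :: "(real \<Rightarrow> complex) \<Rightarrow> (real \<Rightarrow> complex) \<Rightarrow> bool" where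
  "H1_deriv u u' \<longleftrightarrow> square_integrable u \<and> square_integrable u' \<and>
     (\<forall>a b. a \<le> b \<longrightarrow> u b - u a = (LINT x:{a..b}|lborel. u' x))"

lemma H1_deriv_is_primitive: "H1_deriv u u' \<Longrightarrow> is_primitive u u'"
  by (auto simp: H1_deriv_def is_primitive_def square_integrable_measurable square_integrable_set_integrable)

lemma H1_deriv_add:
  assumes "H1_deriv u u'" "H1_deriv v v'"
  shows "H1_deriv (\<lambda>x. u x + v x) (\<lambda>x. u' x + v' x)"
  using assms unfolding H1_deriv_def
  by (auto simp: square_integrable_add(1) square_integrable_set_integrable set_integral_add(2) algebra_simps)

lemma H1_deriv_cmult:
  assumes "H1_deriv u u'"
  shows "H1_deriv (\<lambda>x. c * u x) (\<lambda>x. c * u' x)"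
  using assms unfolding H1_deriv_def
  by (auto simp: square_integrable_cmult right_diff_distrib[symmetric])

text \<open>
  The integrating factor turns \<open>u' + k u = e\<^bsup>- k x\<^esup> g\<close> into \<open>(e\<^bsup>k x\<^esup> u)' = g\<close>.
\<close>

lemma H1_deriv_exp_increment:
  fixes u u' g :: "real \<Rightarrow> complex" and k :: complex and a b :: real
  assumes H: "H1_deriv u u'" and eq: "AE x in lborel. u' x + k * u x = exp (- k * x) * g x"
    and [measurable]: "g \<in> borel_measurable borel" and ab: "a \<le> b"
  shows "exp (k * b) * u b - exp (k * a) * u a = (LINT x:{a..b}|lborel. g x)"
proof -
  note p = H1_deriv_is_primitive[OF H]
  then have [measurable]: "u \<in> borel_measurable borel" "u' \<in> borel_measurable borel"
    by (auto simp: is_primitive_def)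
  have "exp (k * b) * u b - exp (k * a) * u a = (LINT x:{a..b}|lborel. exp (k * x) * (u' x + k * u x))"
    using is_primitive_exp_mult[OF p, of k] ab by (simp add: is_primitive_def)
  also have "\<dots> = (LINT x:{a..b}|lborel. g x)"
    by (rule set_lebesgue_integral_cong_AE)
      (use eq in \<open>auto elim!: eventually_mono simp: exp_minus\<close>)
  finally show ?thesis .
qed

text \<open>
  Solutions of the homogeneous equation are multiples of \<open>e\<^bsup>- k x\<^esup>\<close>, whose modulus is at least \<open>1\<close> on one
  of the two half-lines, whatever the sign of \<open>Re k\<close>.
\<close>

lemma first_order_kernel_trivial:
  fixes k :: complex
  assumes H: "H1_deriv u u'" and eq: "AE x in lborel. u' x + k * u x = 0"
  shows "u x = 0"
proof -
  define C where "C = u 0"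
  have inc: "exp (k * b) * u b = exp (k * a) * u a" if "a \<le> b" for a b :: real
    using H1_deriv_exp_increment[OF H, of k "\<lambda>_. 0" a b] eq that by simp
  have ux: "u x = C * exp (- (k * x))" for x
    using inc[of 0 x] inc[of x 0] by (cases "0 \<le> x") (auto simp: C_def exp_minus field_simps)
  have sq: "square_integrable u" using H by (simp add: H1_deriv_def)
  have "C = 0"
  proof (rule ccontr)
    assume C: "C \<noteq> 0"
    define S where "S = (if 0 \<le> Re k then {..0::real} else {0..})"
    show False
    proof (rule square_integrable_not_bounded_below[OF sq])
      show "S \<in> sets borel" "emeasure lborel S = \<infinity>" 
        by (auto simp: S_def emeasure_lborel_half_lines)
      show "norm C > 0" using C by simp
      show "norm C \<le> norm (u x)" if "x \<in> S" for x
      proof -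
        have "Re k * x \<le> 0"
          using that by (auto simp: S_def mult_nonneg_nonpos mult_nonpos_nonneg split: if_splits)
        then have "norm C * 1 \<le> norm C * exp (- (Re k * x))"
          by (intro mult_left_mono) auto
        then show ?thesis by (simp add: ux norm_mult)
      qed
    qed
  qed
  then show ?thesis by (simp add: ux)
qed

text \<open>
  On the imaginary axis, \<open>w = e\<^bsup>k x\<^esup> u\<close> has the same modulus as \<open>u\<close>. The forcing is chosen such that
  \<open>w' = 1\<close> on \<open>[0, 1]\<close> and \<open>w' = 0\<close> elsewhere. Then \<open>w\<close> is constant on both half-lines, and square
  integrability makes both constants zero although they differ by \<open>1\<close>.
\<close>

lemma resonant_forcing_unsolvable:
  fixes k :: complex
  assumes k: "Re k = 0" and H: "H1_deriv u u'"
    and eq: "AE x in lborel. u' x + k * u x = exp (- k * x) * indicator {0..1} x"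
  shows False
proof -
  define w where "w x = exp (k * x) * u x" for x :: real
  have sq: "square_integrable u" using H by (simp add: H1_deriv_def)
  have inc: "w b - w a = (LINT x:{a..b}|lborel. indicator {0..1} x)" if "a \<le> b" for a b
    unfolding w_def by (rule H1_deriv_exp_increment[OF H eq _ that]) simp
  have inc': "w b - w a = measure lborel ({a..b} \<inter> {0..1})" if "a \<le> b" for a b
  proof -
    have "indicator {a..b} x *\<^sub>R (indicator {0..1} x :: complex) = of_real (indicator ({a..b} \<inter> {0..1}) x)" for x :: real
      by (simp add: indicator_def)
    then show ?thesis unfolding inc[OF that] set_lebesgue_integral_def by simp
  qed
  have nw: "norm (u x) = norm (w x)" for x using k by (simp add: w_def norm_mult)
  have "w 0 = 0"
  proof (rule ccontr)
    assume 0: "w 0 \<noteq> 0"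
    have "w x = w 0" if "x \<le> 0" for x
    proof -
      have "{x..0} \<inter> {0..1} = {0::real}" using that by auto
      then show ?thesis using inc'[OF that] by simp
    qed
    then have "norm (w 0) \<le> norm (u x)" if "x \<in> {..0}" for x
      using that nw[of x] by (metis atLeast_iff atMost_iff order_refl)
    then show False
      using square_integrable_not_bounded_below[OF sq, of "{..0}" "norm (w 0)"] 0
      by (simp add: emeasure_lborel_half_lines)
  qed
  moreover have "w 1 = 0"
  proof (rule ccontr)
    assume 0: "w 1 \<noteq> 0"
    have "w x = w 1" if "1 \<le> x" for x
    proof -
      have "{1..x} \<inter> {0..1} = {1::real}" using that by auto
      then show ?thesis using inc'[OF that] by simp
    qed
    then have "norm (w 1) \<le> norm (u x)" if "x \<in> {1..}" for x
      using that nw[of x] by (metis atLeast_iff atMost_iff order_refl)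
    then show False
      using square_integrable_not_bounded_below[OF sq, of "{1..}" "norm (w 1)"] 0
      by (simp add: emeasure_lborel_half_lines)
  qed
  ultimately show False using inc'[of 0 1] by simp
qed

lemma has_bochner_integral_exp_decay:
  fixes r :: real
  assumes r: "r > 0"
  shows "has_bochner_integral lborel (\<lambda>x. if y \<le> x then exp (- (r * (x - y))) else 0) (1 / r)" (is "?A y")
    and "has_bochner_integral lborel (\<lambda>y. if y \<le> x then exp (- (r * (x - y))) else 0) (1 / r)"
proof -
  show A: "?A y" for y
  proof (rule has_bochner_integral_nn_integral)
    have eq: "(\<integral>\<^sup>+x. ennreal (exp (- (r * (x - y)))) * indicator {y..} x \<partial>lborel)
        = ennreal (0 - (- (exp (- (r * (y - y))) / r)))"
    proof (rule nn_integral_FTC_atLeast[where F = "\<lambda>x. - (exp (- (r * (x - y))) / r)" and T = 0])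
      show "DERIV (\<lambda>x. - (exp (- (r * (x - y))) / r)) x :> exp (- (r * (x - y)))" for x
        using r by (auto intro!: derivative_eq_intros)
      have "filterlim (\<lambda>x. r * (x - y)) at_top at_top"
        unfolding filterlim_at_top eventually_at_top_linorder
      proof (intro allI exI impI)
        show "Z \<le> r * (x - y)" if "Z / r + y \<le> x" for Z x
        proof -
          have "r * (Z / r) \<le> r * (x - y)" using that r by (intro mult_left_mono) auto
          then show ?thesis using r by simp
        qed
      qed
      then have "((\<lambda>x. exp (- (r * (x - y)))) \<longlongrightarrow> 0) at_top"
        by (intro filterlim_compose[OF exp_at_bot]) (simp add: filterlim_uminus_at_bot)
      from tendsto_minus[OF tendsto_divide[OF this tendsto_const[of r]]] r
      show "((\<lambda>x. - (exp (- (r * (x - y))) / r)) \<longlongrightarrow> 0) at_top" by simp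
    qed auto
    have "(\<integral>\<^sup>+x. ennreal (if y \<le> x then exp (- (r * (x - y))) else 0) \<partial>lborel)
        = (\<integral>\<^sup>+x. ennreal (exp (- (r * (x - y)))) * indicator {y..} x \<partial>lborel)"
      by (intro nn_integral_cong) auto
    then show "(\<integral>\<^sup>+x. ennreal (if y \<le> x then exp (- (r * (x - y))) else 0) \<partial>lborel) = ennreal (1 / r)"
      unfolding eq by simp
  qed (use r in auto)
  have "has_bochner_integral lborel (\<lambda>y. if - x \<le> 0 + (-1) * y then exp (- (r * ((0 + (-1) * y) - (- x)))) else 0) ((1 / r) /\<^sub>R \<bar>-1\<bar>)"
    using A[of "- x"] by (subst lborel_has_bochner_integral_real_affine_iff[symmetric]) auto
  then show "has_bochner_integral lborel (\<lambda>y. if y \<le> x then exp (- (r * (x - y))) else 0) (1 / r)"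
    by (simp cong: if_cong)
qed

text \<open>
  The solution is the convolution \<open>u x = \<integral> e\<^bsup>- k (x - y)\<^esup> v y dy\<close> over \<open>y \<le> x\<close>. With
  \<open>W x y = e\<^bsup>- Re k (x - y)\<^esup>\<close> for \<open>y \<le> x\<close>, whose integral in either variable is \<open>1 / Re k\<close>, the
  Cauchy-Schwarz inequality gives \<open>\<bar>u x\<bar>\<^sup>2 \<le> (1 / Re k) \<integral> W x y \<bar>v y\<bar>\<^sup>2 dy\<close>, and integrating in \<open>x\<close> with
  Fubini's theorem gives the bound.
\<close>

lemma first_order_solvable_pos:
  fixes k :: complex and v :: "real \<Rightarrow> complex"
  assumes k: "Re k > 0" and v: "square_integrable v"
  shows "\<exists>u. H1_deriv u (\<lambda>x. v x - k * u x) \<and> L2_sq u \<le> L2_sq v / (Re k)\<^sup>2"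
proof -
  define r where "r = Re k"
  have r: "r > 0" using k by (simp add: r_def)
  have [measurable]: "v \<in> borel_measurable borel" using v by (rule square_integrable_measurable)
  have iv: "integrable lborel (\<lambda>y. (norm (v y))\<^sup>2)" using v by (simp add: square_integrable_def)
  define W where "W x y = (if y \<le> x then exp (- (r * (x - y))) else 0)" for x y :: real
  define F where "F x y = (if y \<le> x then exp (- (k * (x - y))) * v y else 0)" for x y :: real
  define u where "u x = (LINT y|lborel. F x y)" for x
  have [measurable]: "(\<lambda>(x, y). W x y) \<in> borel_measurable (borel \<Otimes>\<^sub>M borel)" 
     "(\<lambda>(x, y). F x y) \<in> borel_measurable (borel \<Otimes>\<^sub>M borel)" 
     "\<And>x. W x \<in> borel_measurable borel"  "\<And>x. F x \<in> borel_measurable borel"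
     "\<And>y. (\<lambda>x. W x y) \<in> borel_measurable borel"
    unfolding W_def F_def by measurable
  have mu[measurable]: "u \<in> borel_measurable borel"
    using lborel.borel_measurable_lebesgue_integral[of "\<lambda>x y. F x y" borel]
    unfolding u_def by simp
  have W01: "0 \<le> W x y" "W x y \<le> 1" for x y using r by (auto simp: W_def)
  have Wx: "integrable lborel (\<lambda>x. W x y)" "(LINT x|lborel. W x y) = 1 / r" for y
    using has_bochner_integral_exp_decay(1)[OF r, of y] by (auto simp: W_def has_bochner_integral_iff)
  have Wy: "integrable lborel (W x)" "(LINT y|lborel. W x y) = 1 / r" for x
    using has_bochner_integral_exp_decay(2)[OF r, of x] by (auto simp: W_def[abs_def] has_bochner_integral_iff)
  have iWv2: "integrable lborel (\<lambda>y. W x y * (norm (v y))\<^sup>2)" for x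
    by (rule Bochner_Integration.integrable_bound[OF iv])
      (use W01 in \<open>auto simp: abs_mult intro!: mult_left_le_one_le\<close>)
  have iWv: "integrable lborel (\<lambda>y. W x y * norm (v y))" for x
  proof (rule Bochner_Integration.integrable_bound[OF Bochner_Integration.integrable_add[OF Wy(1)[of x] iWv2[of x]]])
    show "AE y in lborel. norm (W x y * norm (v y)) \<le> norm (W x y + W x y * (norm (v y))\<^sup>2)"
    proof (rule AE_I2)
      fix y
      have "W x y * norm (v y) \<le> W x y * (1 + (norm (v y))\<^sup>2)"
        using le_one_plus_square W01 by (intro mult_left_mono) auto
      then show "norm (W x y * norm (v y)) \<le> norm (W x y + W x y * (norm (v y))\<^sup>2)"
        using W01[of x y] by (simp add: algebra_simps)
    qed
  qed simp
  have nF: "norm (F x y) = W x y * norm (v y)" for x y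
    by (simp add: F_def W_def norm_mult r_def)
  have iF: "integrable lborel (F x)" for x
    by (rule Bochner_Integration.integrable_bound[OF iWv[of x]]) (simp_all add: nF)
  have CS: "(norm (u x))\<^sup>2 \<le> (1 / r) * (LINT y|lborel. W x y * (norm (v y))\<^sup>2)" for x
  proof -
    define m where "m = (LINT y|lborel. W x y * norm (v y))"
    have "norm (u x) \<le> m"
      unfolding u_def m_def using integral_norm_bound[of lborel "F x"] by (simp add: nF)
    then have um: "(norm (u x))\<^sup>2 \<le> m\<^sup>2" by (intro power_mono) auto
    \<comment> \<open>Cauchy-Schwarz as nonnegativity of a variance: \<open>r * m\<close> is the mean of \<open>norm v\<close> under the probability density \<open>r * W x\<close>\<close>
    have "0 \<le> (LINT y|lborel. W x y * (norm (v y) - r * m)\<^sup>2)"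
      using W01 by (intro integral_nonneg_AE) auto
    also have "\<dots> = (LINT y|lborel. W x y * (norm (v y))\<^sup>2 - (2 * r * m) * (W x y * norm (v y)) + (r * m)\<^sup>2 * W x y)"
      by (intro Bochner_Integration.integral_cong) (auto simp: power2_eq_square algebra_simps)
    also have "\<dots> = (LINT y|lborel. W x y * (norm (v y))\<^sup>2) - (2 * r * m) * m + (r * m)\<^sup>2 * (1 / r)"
      using iWv2[of x] iWv[of x] Wy[of x] by (simp add: m_def)
    also have "\<dots> = (LINT y|lborel. W x y * (norm (v y))\<^sup>2) - r * m\<^sup>2"
      using r by (simp add: power2_eq_square)
    finally have "m\<^sup>2 \<le> (1 / r) * (LINT y|lborel. W x y * (norm (v y))\<^sup>2)"
      using r by (simp add: field_simps)
    with um show ?thesis by simp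
  qed
  have pair: "integrable (lborel \<Otimes>\<^sub>M lborel) (\<lambda>(y, x). W x y * (norm (v y))\<^sup>2)"
  proof (rule lborel_pair.Fubini_integrable)
    show "AE y in lborel. integrable lborel (\<lambda>x. case (y, x) of (y, x) \<Rightarrow> W x y * (norm (v y))\<^sup>2)"
      using Wx by auto
    show "integrable lborel (\<lambda>y. LINT x|lborel. norm (case (y, x) of (y, x) \<Rightarrow> W x y * (norm (v y))\<^sup>2))"
      using iv Wx(2) by (simp add: abs_mult W01)
  qed measurable
  have iu: "integrable lborel (\<lambda>x. (1 / r) * (LINT y|lborel. W x y * (norm (v y))\<^sup>2))"
    using lborel_pair.integrable_snd[OF pair] by simp
  have iu2: "integrable lborel (\<lambda>x. (norm (u x))\<^sup>2)"
  proof (rule Bochner_Integration.integrable_bound[OF iu _ AE_I2])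
    show "norm ((norm (u x))\<^sup>2) \<le> norm ((1 / r) * (LINT y|lborel. W x y * (norm (v y))\<^sup>2))" for x
      using CS[of x] zero_le_power2[of "norm (u x)"] unfolding real_norm_def by linarith
  qed simp
  have squ: "square_integrable u" using iu2 by (simp add: square_integrable_def)
  have "L2_sq u \<le> (LINT x|lborel. (1 / r) * (LINT y|lborel. W x y * (norm (v y))\<^sup>2))"
    unfolding L2_sq_def by (rule integral_mono[OF iu2 iu CS])
  also have "\<dots> = (1 / r) * (LINT y|lborel. LINT x|lborel. W x y * (norm (v y))\<^sup>2)"
    using lborel_pair.Fubini_integral[OF pair] by simp
  also have "\<dots> = L2_sq v / r\<^sup>2"
    using Wx(2) by (simp add: L2_sq_def power2_eq_square)
  finally have bound: "L2_sq u \<le> L2_sq v / r\<^sup>2" .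
  \<comment> \<open>The convolution is \<open>e\<^bsup>- k x\<^esup> U\<close> with a genuine primitive \<open>U\<close>, so the product rule applies to it.\<close>
  define U where "U x = exp (k * x) * u x" for x :: real
  have U: "U x = (LINT y|lborel. exp (k * x) * F x y)" for x
    using iF by (simp add: U_def u_def)
  have "is_primitive U (\<lambda>y. exp (k * y) * v y)"
    unfolding is_primitive_def
  proof (intro conjI allI impI)
    show "U \<in> borel_measurable borel" unfolding U_def by measurable
    show "(\<lambda>y. exp (k * y) * v y) \<in> borel_measurable borel" by measurable
    fix a b :: real assume ab: "a \<le> b"
    have "integrable lborel (\<lambda>y. indicator {a..b} y *\<^sub>R (exp (k * b) * F b y))"
      using iF[of b] by (intro integrable_mult_indicator) auto
    also have "(\<lambda>y. indicator {a..b} y *\<^sub>R (exp (k * b) * F b y)) = (\<lambda>y. indicator {a..b} y *\<^sub>R (exp (k * y) * v y))"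
      by (auto simp: F_def fun_eq_iff indicator_def mult.assoc[symmetric] exp_add[symmetric] algebra_simps)
    finally show "set_integrable lborel {a..b} (\<lambda>y. exp (k * y) * v y)"
      by (simp add: set_integrable_def)
    have "U b - U a = (LINT y|lborel. exp (k * b) * F b y - exp (k * a) * F a y)"
      unfolding U using iF by simp
    also have "\<dots> = (LINT y:{a..b}|lborel. exp (k * y) * v y)"
      unfolding set_lebesgue_integral_def
    proof (rule integral_cong_AE)
      show "AE y in lborel. exp (k * b) * F b y - exp (k * a) * F a y = indicator {a..b} y *\<^sub>R (exp (k * y) * v y)"
        using AE_lborel_singleton[of a]
        by eventually_elim (use ab in \<open>auto simp: F_def indicator_def mult.assoc[symmetric] exp_add[symmetric] algebra_simps\<close>)
    qed measurable
    finally show "U b - U a = (LINT y:{a..b}|lborel. exp (k * y) * v y)" .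
  qed
  from is_primitive_exp_mult[OF this, of "- k"]
  have "is_primitive (\<lambda>x::real. exp (- k * x) * U x) (\<lambda>x. exp (- k * x) * (exp (k * x) * v x + - k * U x))" .
  moreover have cancel: "exp (- (k * x)) * (exp (k * x) * z) = z" for x :: real and z
    by (simp add: exp_minus)
  ultimately have "is_primitive u (\<lambda>x. v x - k * u x)"
    by (simp add: cancel U_def distrib_left right_diff_distrib mult.left_commute[of _ k])
  then have "H1_deriv u (\<lambda>x. v x - k * u x)"
    using squ square_integrable_add(1)[OF v square_integrable_cmult[OF squ, of "- k"]]
    by (simp add: H1_deriv_def is_primitive_def)
  with bound show ?thesis unfolding r_def by blast
qed

text \<open>
  For \<open>Re k < 0\<close> the reflection \<open>x \<mapsto> - x\<close> reduces the equation to the parameter \<open>- k\<close>.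
\<close>

lemma first_order_solvable:
  fixes k :: complex and v :: "real \<Rightarrow> complex"
  assumes k: "Re k \<noteq> 0" and v: "square_integrable v"
  shows "\<exists>u. H1_deriv u (\<lambda>x. v x - k * u x) \<and> L2_sq u \<le> L2_sq v / (Re k)\<^sup>2"
proof (cases "Re k > 0")
  case True then show ?thesis using first_order_solvable_pos v by blast
next
  case False
  have reflect: "square_integrable (\<lambda>x. f (- x))" "L2_sq (\<lambda>x. f (- x)) = L2_sq f"
    if "square_integrable f" for f :: "real \<Rightarrow> complex"
  proof -
    note [measurable] = square_integrable_measurable[OF that]
    show "square_integrable (\<lambda>x. f (- x))"
      using that lborel_integrable_real_affine_iff[of "-1" "\<lambda>x. (norm (f x))\<^sup>2" 0]
      by (simp add: square_integrable_def)
    show "L2_sq (\<lambda>x. f (- x)) = L2_sq f"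
      using lborel_integral_real_affine[of "-1" "\<lambda>x. (norm (f x))\<^sup>2" 0]
      by (simp add: L2_sq_def)
  qed
  have "Re (- k) > 0" using False k by simp
  from first_order_solvable_pos[OF this reflect(1)[OF v]]
  obtain w where w: "H1_deriv w (\<lambda>x. v (- x) + k * w x)" "L2_sq w \<le> L2_sq v / (Re k)\<^sup>2"
    using reflect(2)[OF v] by auto
  define u where "u x = - w (- x)" for x
  have sw: "square_integrable w" and
    inc: "\<And>a b. a \<le> b \<Longrightarrow> w b - w a = (LINT x:{a..b}|lborel. v (- x) + k * w x)"
    using w(1) by (auto simp: H1_deriv_def)
  have u: "square_integrable u" "L2_sq u = L2_sq w"
    using reflect[OF sw] square_integrable_cmult[of "\<lambda>x. w (- x)" "-1"]
    by (simp_all add: u_def[abs_def] L2_sq_def)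
  have "u b - u a = (LINT x:{a..b}|lborel. v x - k * u x)" if "a \<le> b" for a b
  proof -
    have "u b - u a = (LINT x|lborel. indicator {-b..-a} x *\<^sub>R (v (- x) + k * w x))"
      using inc[of "-b" "-a"] that by (simp add: u_def set_lebesgue_integral_def)
    also have "\<dots> = (LINT x|lborel. indicator {-b..-a} (- x) *\<^sub>R (v x + k * w (- x)))"
      using lborel_integral_real_affine[of "-1" "\<lambda>x. indicator {-b..-a} x *\<^sub>R (v (- x) + k * w x)" 0] by simp
    also have "\<dots> = (LINT x:{a..b}|lborel. v x - k * u x)"
      unfolding set_lebesgue_integral_def
      by (intro Bochner_Integration.integral_cong) (auto simp: u_def indicator_def)
    finally show ?thesis .
  qed
  then have "H1_deriv u (\<lambda>x. v x - k * u x)"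
    using u(1) square_integrable_add(1)[OF v square_integrable_cmult[OF u(1), of "- k"]]
    by (simp add: H1_deriv_def)
  then show ?thesis using w(2) u(2) by auto
qed

section \<open>Second-order equations on the line\<close>

text \<open>
  If \<open>u'' = k\<^sup>2 u\<close>, then \<open>v = u' - k u\<close> satisfies \<open>v' + k v = 0\<close>; so \<open>v\<close> vanishes, and then \<open>u\<close>.
\<close>

lemma second_order_kernel_trivial:
  assumes "H1_deriv u u'" "H1_deriv u' u''" and eq: "AE x in lborel. u'' x = k\<^sup>2 * u x"
  shows "u x = 0"
proof -
  have H: "H1_deriv (\<lambda>x. u' x + (- k) * u x) (\<lambda>x. u'' x + (- k) * u' x)"
    using assms by (intro H1_deriv_add H1_deriv_cmult)
  have "u' x + (- k) * u x = 0" for x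
    by (rule first_order_kernel_trivial[OF H, of k])
      (use eq in \<open>auto elim!: eventually_mono simp: power2_eq_square algebra_simps\<close>)
  then show ?thesis
    by (intro first_order_kernel_trivial[OF assms(1), of "- k"]) simp
qed

text \<open>
  Solve \<open>v' + k v = g\<close> and then \<open>u' - k u = v\<close>.
\<close>

lemma second_order_solvable:
  assumes k: "Re k \<noteq> 0" and g: "square_integrable g"
  shows "\<exists>u u'. H1_deriv u u' \<and> H1_deriv u' (\<lambda>x. k\<^sup>2 * u x + g x) \<and> L2_sq u \<le> L2_sq g / (Re k) ^ 4"
proof -
  obtain v where v: "H1_deriv v (\<lambda>x. g x - k * v x)" "L2_sq v \<le> L2_sq g / (Re k)\<^sup>2"
    using first_order_solvable[OF k g] by blast
  have sv: "square_integrable v" using v(1) by (simp add: H1_deriv_def)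
  obtain u where u: "H1_deriv u (\<lambda>x. v x + k * u x)" "L2_sq u \<le> L2_sq v / (Re k)\<^sup>2"
    using first_order_solvable[of "- k", OF _ sv] k by auto
  have "H1_deriv (\<lambda>x. v x + k * u x) (\<lambda>x. g x - k * v x + k * (v x + k * u x))"
    using u(1) v(1) by (intro H1_deriv_add H1_deriv_cmult)
  moreover have "(\<lambda>x. g x - k * v x + k * (v x + k * u x)) = (\<lambda>x. k\<^sup>2 * u x + g x)"
    by (simp add: fun_eq_iff power2_eq_square algebra_simps)
  moreover have "L2_sq u \<le> L2_sq g / (Re k) ^ 4"
    using u(2) divide_right_mono[OF v(2), of "(Re k)\<^sup>2"] by (simp add: power_numeral_reduce power2_eq_square)
  ultimately show ?thesis using u(1) by auto
qed

text \<open>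
  Here \<open>k = i l\<close>, and \<open>u' - i l u\<close> would solve the resonantly forced first-order equation.
\<close>

lemma second_order_unsolvable:
  fixes l :: real
  assumes "H1_deriv u u'" "H1_deriv u' u''"
    and eq: "AE x in lborel. u'' x = - (of_real l)\<^sup>2 * u x + exp (- (\<i> * l) * x) * indicator {0..1} x"
  shows False
proof -
  have H: "H1_deriv (\<lambda>x. u' x + (- (\<i> * l)) * u x) (\<lambda>x. u'' x + (- (\<i> * l)) * u' x)"
    using assms by (intro H1_deriv_add H1_deriv_cmult)
  show False
    by (rule resonant_forcing_unsolvable[OF _ H, of "\<i> * l"])
      (use eq in \<open>auto elim!: eventually_mono simp: power2_eq_square algebra_simps\<close>)
qed

section \<open>The linearized equation and its two scalar modes\<close>

text \<open>
  The factor \<open>m \<times> e\<^sub>3\<close> vanishes at \<open>m = \<sigma> e\<^sub>3\<close>. Hence the derivative of the coefficient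
  \<open>\<beta> / (1 + c m\<^sub>3)\<close> drops out and only its value at the state survives.
\<close>

lemma has_derivative_llg_residual_constant_state:
  fixes c \<sigma> :: real
  assumes "1 + c * \<sigma> \<noteq> 0"
  shows "((\<lambda>(m, mt, mxx). llg_residual \<alpha> \<mu> h \<beta> c m mt mxx) has_derivative
    (\<lambda>(n, nt, nxx). nt - (cross3 (\<sigma> *\<^sub>R e3) (\<alpha> *\<^sub>R nt - nxx + (\<mu> * n $ 3) *\<^sub>R e3 + (\<beta> / (1 + c * \<sigma>)) *\<^sub>R cross3 n e3)
       + cross3 n ((\<mu> * \<sigma> - h) *\<^sub>R e3)))) (at (\<sigma> *\<^sub>R e3, 0, 0))"
proof -
  let ?s = "(\<sigma> *\<^sub>R e3, 0, 0) :: (real^3) \<times> (real^3) \<times> (real^3)"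
  let ?coeff = "\<lambda>p :: (real^3) \<times> (real^3) \<times> (real^3). \<beta> / (1 + c * fst p $ 3)"
  have cross: "bounded_bilinear cross3"
    using bilinear_cross bilinear_conv_bounded_bilinear by blast
  note d_cross = bounded_bilinear.FDERIV[OF cross]
  have e33: "e3 $ 3 = 1" by (simp add: e3_def axis_def)
  have cee: "cross3 (\<sigma> *\<^sub>R e3) e3 = 0" by (simp add: cross_mult_left)
  have d3: "((\<lambda>p. fst p $ 3) has_derivative (\<lambda>q. fst q $ 3)) (at ?s)"
    by (intro bounded_linear.has_derivative[OF bounded_linear_vec_nth] derivative_intros)
  have d1: "((\<lambda>p. 1 + c * fst p $ 3) has_derivative (\<lambda>q. c * fst q $ 3)) (at ?s)"
    by (auto intro!: derivative_eq_intros d3)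
  have "1 + c * fst ?s $ 3 \<noteq> 0" using assms by (simp add: e33)
  then obtain D where d_coeff: "(?coeff has_derivative D) (at ?s)"
    using has_derivative_divide[OF has_derivative_const[of \<beta>] d1] by blast
  have d_me: "((\<lambda>p :: (real^3) \<times> (real^3) \<times> (real^3). cross3 (fst p) e3) has_derivative (\<lambda>q. cross3 (fst q) e3)) (at ?s)"
    by (intro bounded_linear.has_derivative[OF bounded_bilinear.bounded_linear_left[OF cross]] derivative_intros)
  have d_drive: "((\<lambda>p. ?coeff p *\<^sub>R cross3 (fst p) e3) has_derivative
      (\<lambda>q. (\<beta> / (1 + c * \<sigma>)) *\<^sub>R cross3 (fst q) e3)) (at ?s)"
    using has_derivative_scaleR[OF d_coeff d_me] by (simp add: e33 cee)
  have d_lin: "((\<lambda>p. \<alpha> *\<^sub>R fst (snd p) - snd (snd p) + (\<mu> * fst p $ 3 - h) *\<^sub>R e3) has_derivative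
      (\<lambda>q. \<alpha> *\<^sub>R fst (snd q) - snd (snd q) + (\<mu> * fst q $ 3) *\<^sub>R e3)) (at ?s)"
    by (auto intro!: derivative_eq_intros d3 simp: e33)
  note d_field = has_derivative_add[OF d_lin d_drive]
  have "((\<lambda>p. fst (snd p) - cross3 (fst p) (\<alpha> *\<^sub>R fst (snd p) - snd (snd p) + (\<mu> * fst p $ 3 - h) *\<^sub>R e3 + ?coeff p *\<^sub>R cross3 (fst p) e3)) has_derivative
      (\<lambda>q. fst (snd q) - (cross3 (\<sigma> *\<^sub>R e3) (\<alpha> *\<^sub>R fst (snd q) - snd (snd q) + (\<mu> * fst q $ 3) *\<^sub>R e3 + (\<beta> / (1 + c * \<sigma>)) *\<^sub>R cross3 (fst q) e3)
       + cross3 (fst q) ((\<mu> * \<sigma> - h) *\<^sub>R e3)))) (at ?s)"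
    using has_derivative_diff[OF has_derivative_fst[OF has_derivative_snd[OF has_derivative_ident]]
        d_cross[OF has_derivative_fst[OF has_derivative_ident] d_field]]
    by (simp add: e33 cee)
  then show ?thesis by (simp add: case_prod_unfold llg_residual_def)
qed

lemma linearized_eq_constant_state:
  fixes c \<sigma> :: real
  assumes "1 + c * \<sigma> \<noteq> 0"
  shows "linearized_eq \<alpha> \<mu> h \<beta> c (\<sigma> *\<^sub>R e3) n nt nxx \<longleftrightarrow>
    nt $ 1 - (\<mu> * \<sigma> - h) * n $ 2 + \<sigma> * \<alpha> * nt $ 2 - \<sigma> * nxx $ 2 - \<sigma> * (\<beta> / (1 + c * \<sigma>)) * n $ 1 = 0 \<and>
    nt $ 2 + (\<mu> * \<sigma> - h) * n $ 1 - \<sigma> * \<alpha> * nt $ 1 + \<sigma> * nxx $ 1 - \<sigma> * (\<beta> / (1 + c * \<sigma>)) * n $ 2 = 0"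
  unfolding linearized_eq_def frechet_derivative_at[OF has_derivative_llg_residual_constant_state[OF assms], symmetric]
  by (simp add: tangential_def vec_eq_iff forall_3 cross3_def vector_3 e3_def axis_def algebra_simps)

text \<open>
  On the tangent plane \<open>e\<^sub>3 \<times> _\<close> is the rotation by a right angle, with eigenvalues \<open>\<plusminus> i\<close>; this is the
  left eigenvector for \<open>i \<kappa> \<sigma>\<close>. The factor \<open>\<sigma>\<close> is included so that the mode equations depend on the
  state only through the constants \<open>B\<close> and \<open>d\<close>.
\<close>

definition mode :: "real \<Rightarrow> complex \<Rightarrow> complex^2 \<Rightarrow> complex" where
  "mode \<sigma> \<kappa> n = n $ 1 + \<i> * \<kappa> * \<sigma> * n $ 2"

text \<open>
  With \<open>E1\<close> and \<open>E2\<close> the components of the linearized equation, the mode equation for \<open>\<kappa>\<close> is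
  \<open>E1 + i \<kappa> \<sigma> E2 = 0\<close> multiplied by \<open>i \<kappa>\<close>.
\<close>

lemma linearized_eq_complex_iff_modes:
  fixes c \<sigma> :: real
  assumes c: "1 + c * \<sigma> \<noteq> 0" and \<sigma>: "\<sigma> = 1 \<or> \<sigma> = -1"
  shows "linearized_eq_complex \<alpha> \<mu> h \<beta> c (\<sigma> *\<^sub>R e3) n nt nxx \<longleftrightarrow>
    (\<forall>\<kappa>\<in>{1, -1}. mode \<sigma> \<kappa> nxx =
       (\<alpha> + \<i> * \<kappa>) * mode \<sigma> \<kappa> nt - (\<i> * \<kappa> * complex_of_real (\<sigma> * \<beta> / (1 + c * \<sigma>)) + complex_of_real (\<mu> - \<sigma> * h)) * mode \<sigma> \<kappa> n)"
proof -
  define B where "B = \<beta> / (1 + c * \<sigma>)"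
  define E1 where "E1 = nt $ 1 - (\<mu> * \<sigma> - h) * n $ 2 + \<sigma> * \<alpha> * nt $ 2 - \<sigma> * nxx $ 2 - \<sigma> * B * n $ 1"
  define E2 where "E2 = nt $ 2 + (\<mu> * \<sigma> - h) * n $ 1 - \<sigma> * \<alpha> * nt $ 1 + \<sigma> * nxx $ 1 - \<sigma> * B * n $ 2"
  have "linearized_eq_complex \<alpha> \<mu> h \<beta> c (\<sigma> *\<^sub>R e3) n nt nxx \<longleftrightarrow> E1 = 0 \<and> E2 = 0"
    unfolding linearized_eq_complex_def linearized_eq_constant_state[OF c] E1_def E2_def B_def[symmetric]
    by (auto simp: complex_eq_iff)
  also have "\<dots> \<longleftrightarrow> (\<forall>\<kappa>\<in>{1, -1}. E1 + \<i> * \<kappa> * \<sigma> * E2 = 0)"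
    unfolding ball_simps using \<sigma> by (auto simp: complex_eq_iff)
  also have "\<dots> \<longleftrightarrow> (\<forall>\<kappa>\<in>{1, -1}. mode \<sigma> \<kappa> nxx =
       (\<alpha> + \<i> * \<kappa>) * mode \<sigma> \<kappa> nt - (\<i> * \<kappa> * complex_of_real (\<sigma> * B) + complex_of_real (\<mu> - \<sigma> * h)) * mode \<sigma> \<kappa> n)"
  proof (intro ball_cong refl)
    fix \<kappa> :: complex assume "\<kappa> \<in> {1, -1}"
    then show "E1 + \<i> * \<kappa> * \<sigma> * E2 = 0 \<longleftrightarrow> mode \<sigma> \<kappa> nxx =
       (\<alpha> + \<i> * \<kappa>) * mode \<sigma> \<kappa> nt - (\<i> * \<kappa> * complex_of_real (\<sigma> * B) + complex_of_real (\<mu> - \<sigma> * h)) * mode \<sigma> \<kappa> n"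
      using \<sigma> unfolding E1_def E2_def mode_def
      by (elim insertE disjE emptyE; simp; simp add: complex_eq_iff algebra_simps; linarith)
  qed
  finally show ?thesis by (simp add: B_def)
qed

text \<open>
  The right eigenvectors dual to \<open>mode\<close>.
\<close>

definition of_mode :: "real \<Rightarrow> complex \<Rightarrow> complex \<Rightarrow> complex^2" where
  "of_mode \<sigma> \<kappa> w = vector [w / 2, - \<i> * \<kappa> * \<sigma> * w / 2]"

lemma mode_of_mode:
  assumes "\<sigma> = 1 \<or> \<sigma> = -1" "\<kappa> \<in> {1, -1}" "\<kappa>' \<in> {1, -1}"
  shows "mode \<sigma> \<kappa>' (of_mode \<sigma> \<kappa> w) = (if \<kappa>' = \<kappa> then w else 0)"
  using assms by (auto simp: mode_def of_mode_def vector_2)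

lemma modes_determine:
  assumes "\<sigma> = 1 \<or> \<sigma> = -1" "mode \<sigma> 1 v = 0" "mode \<sigma> (- 1) v = 0"
  shows "v = 0"
  using assms by (auto simp: mode_def vec_eq_iff forall_2 complex_eq_iff)

lemma bounded_linear_mode: "bounded_linear (mode \<sigma> \<kappa>)"
  unfolding linear_conv_bounded_linear[symmetric]
  by (rule linearI; simp add: mode_def; simp add: algebra_simps scaleR_conv_of_real)

lemma bounded_linear_of_mode: "bounded_linear (of_mode \<sigma> \<kappa>)"
  unfolding linear_conv_bounded_linear[symmetric]
  by (rule linearI; simp add: of_mode_def vec_eq_iff forall_2 vector_2; simp add: scaleR_conv_of_real field_simps)

lemma mode_linear:
  "mode \<sigma> \<kappa> (v + w) = mode \<sigma> \<kappa> v + mode \<sigma> \<kappa> w"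
  "mode \<sigma> \<kappa> (v - w) = mode \<sigma> \<kappa> v - mode \<sigma> \<kappa> w"
  "mode \<sigma> \<kappa> (z *s v) = z * mode \<sigma> \<kappa> v"
  "mode \<sigma> \<kappa> 0 = 0"
  by (simp_all add: mode_def algebra_simps)

lemma mem_L2_iff: "f \<in> L2 \<longleftrightarrow> square_integrable f"
  by (simp add: L2_def square_integrable_def)

lemma L2_norm_eq: "L2_norm f = sqrt (L2_sq f)"
  by (simp add: L2_norm_def L2_sq_def)

lemma set_integral_bounded_linear:
  assumes T: "bounded_linear T" and f: "set_integrable lborel A f"
  shows "(LINT x:A|lborel. T (f x)) = T (LINT x:A|lborel. f x)"
  using integral_bounded_linear[OF T f[unfolded set_integrable_def]]
  by (simp add: set_lebesgue_integral_def linear_cmul[OF bounded_linear.linear[OF T]])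

lemma H1_deriv_mode:
  assumes "u \<in> L2" "u' \<in> L2" "\<And>a b. a \<le> b \<Longrightarrow> u b - u a = (LINT x:{a..b}|lborel. u' x)"
  shows "H1_deriv (\<lambda>x. mode \<sigma> \<kappa> (u x)) (\<lambda>x. mode \<sigma> \<kappa> (u' x))"
  using assms unfolding H1_deriv_def mem_L2_iff
  by (simp add: square_integrable_bounded_linear(1) bounded_linear_mode set_integral_bounded_linear
      square_integrable_set_integrable flip: mode_linear(2))

text \<open>
  A vector profile assembled from two Sobolev amplitudes is itself Sobolev, because the assembly is linear.
\<close>

lemma of_mode_pair_primitive:
  assumes p: "H1_deriv p p'" and q: "H1_deriv q q'" and ab: "a \<le> b"
  shows "(of_mode \<sigma> 1 (p b) + of_mode \<sigma> (- 1) (q b)) - (of_mode \<sigma> 1 (p a) + of_mode \<sigma> (- 1) (q a))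
    = (LINT x:{a..b}|lborel. of_mode \<sigma> 1 (p' x) + of_mode \<sigma> (- 1) (q' x))"
proof -
  have sp: "square_integrable p'" "square_integrable q'" using p q by (auto simp: H1_deriv_def)
  have 1: "of_mode \<sigma> \<kappa> (r b) - of_mode \<sigma> \<kappa> (r a) = (LINT x:{a..b}|lborel. of_mode \<sigma> \<kappa> (r' x))"
    if "H1_deriv r r'" for r r' \<kappa>
    using that ab unfolding H1_deriv_def
    by (simp add: set_integral_bounded_linear[OF bounded_linear_of_mode] square_integrable_set_integrable
        flip: linear_diff[OF bounded_linear.linear[OF bounded_linear_of_mode]])
  have "(LINT x:{a..b}|lborel. of_mode \<sigma> 1 (p' x) + of_mode \<sigma> (- 1) (q' x)) =
    (LINT x:{a..b}|lborel. of_mode \<sigma> 1 (p' x)) + (LINT x:{a..b}|lborel. of_mode \<sigma> (- 1) (q' x))"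
    by (intro set_integral_add square_integrable_set_integrable
        square_integrable_bounded_linear(1)[OF _ bounded_linear_of_mode] sp)
  then show ?thesis using 1[OF p, of 1] 1[OF q, of "- 1"] by (simp add: add_diff_add)
qed

lemma square_integrable_of_mode_pair:
  assumes "square_integrable p" "square_integrable q"
  shows "square_integrable (\<lambda>x. of_mode \<sigma> 1 (p x) + of_mode \<sigma> (- 1) (q x))"
  using assms by (intro square_integrable_add(1) square_integrable_bounded_linear(1)[OF _ bounded_linear_of_mode])

text \<open>
  The equation for the amplitude \<open>p\<close> of the mode \<open>\<kappa>\<close> in the resolvent equation at \<open>z\<close> is
  \<open>p'' = symbol p + (\<alpha> + i \<kappa>) f\<close>, so \<open>e\<^bsup>i l x\<^esup>\<close> is a homogeneous solution iff the symbol is \<open>- l\<^sup>2\<close>.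
\<close>

definition symbol :: "real \<Rightarrow> real \<Rightarrow> real \<Rightarrow> complex \<Rightarrow> complex \<Rightarrow> complex" where
  "symbol \<alpha> B d \<kappa> z = (\<alpha> + \<i> * \<kappa>) * z - (\<i> * \<kappa> * B + d)"

definition dispersion_curve :: "real \<Rightarrow> real \<Rightarrow> real \<Rightarrow> complex set" where
  "dispersion_curve \<alpha> B d = {z. \<exists>\<kappa>\<in>{1, -1}. \<exists>l::real. symbol \<alpha> B d \<kappa> z = - (of_real l)\<^sup>2}"

lemma shifted_eq_modes:
  fixes c \<sigma> :: real
  assumes c: "1 + c * \<sigma> \<noteq> 0" and \<sigma>: "\<sigma> = 1 \<or> \<sigma> = -1" and \<kappa>: "\<kappa> \<in> {1, -1}"
    and S: "shifted_eq (linearization \<alpha> \<mu> h \<beta> c (\<sigma> *\<^sub>R e3)) z u f"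
  shows "u \<in> L2"
    and "\<exists>u' u''. H1_deriv (\<lambda>x. mode \<sigma> \<kappa> (u x)) u' \<and> H1_deriv u' u'' \<and>
      (AE x in lborel. u'' x = symbol \<alpha> (\<sigma> * \<beta> / (1 + c * \<sigma>)) (\<mu> - \<sigma> * h) \<kappa> z * mode \<sigma> \<kappa> (u x)
         + (\<alpha> + \<i> * \<kappa>) * mode \<sigma> \<kappa> (f x))"
proof -
  from S obtain g u' u'' where g: "AE x in lborel. g x - z *s u x = f x"
    and H: "H2_derivs u u' u''"
    and eq: "AE x in lborel. linearized_eq_complex \<alpha> \<mu> h \<beta> c (\<sigma> *\<^sub>R e3) (u x) (g x) (u'' x)"
    unfolding shifted_eq_def linearization_def by auto
  show "u \<in> L2" using H by (simp add: H2_derivs_def)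
  have "H1_deriv (\<lambda>x. mode \<sigma> \<kappa> (u x)) (\<lambda>x. mode \<sigma> \<kappa> (u' x))" "H1_deriv (\<lambda>x. mode \<sigma> \<kappa> (u' x)) (\<lambda>x. mode \<sigma> \<kappa> (u'' x))"
    using H unfolding H2_derivs_def by (auto intro!: H1_deriv_mode)
  moreover have "AE x in lborel. mode \<sigma> \<kappa> (u'' x) = symbol \<alpha> (\<sigma> * \<beta> / (1 + c * \<sigma>)) (\<mu> - \<sigma> * h) \<kappa> z * mode \<sigma> \<kappa> (u x)
         + (\<alpha> + \<i> * \<kappa>) * mode \<sigma> \<kappa> (f x)"
    using g eq
  proof eventually_elim
    case (elim x)
    have "mode \<sigma> \<kappa> (g x) = z * mode \<sigma> \<kappa> (u x) + mode \<sigma> \<kappa> (f x)"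
      unfolding elim(1)[symmetric] by (simp add: mode_linear)
    then show ?case
      using bspec[OF elim(2)[unfolded linearized_eq_complex_iff_modes[OF c \<sigma>]] \<kappa>]
      by (simp add: symbol_def algebra_simps)
  qed
  ultimately show "\<exists>u' u''. H1_deriv (\<lambda>x. mode \<sigma> \<kappa> (u x)) u' \<and> H1_deriv u' u'' \<and>
      (AE x in lborel. u'' x = symbol \<alpha> (\<sigma> * \<beta> / (1 + c * \<sigma>)) (\<mu> - \<sigma> * h) \<kappa> z * mode \<sigma> \<kappa> (u x)
         + (\<alpha> + \<i> * \<kappa>) * mode \<sigma> \<kappa> (f x))" by blast
qed

lemma shifted_eq_of_modes:
  fixes c \<sigma> :: real
  assumes c: "1 + c * \<sigma> \<noteq> 0" and \<sigma>: "\<sigma> = 1 \<or> \<sigma> = -1" and f: "f \<in> L2"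
    and p: "\<And>\<kappa>. \<kappa> \<in> {1, -1} \<Longrightarrow> H1_deriv (p \<kappa>) (p' \<kappa>)"
    and p': "\<And>\<kappa>. \<kappa> \<in> {1, -1} \<Longrightarrow> H1_deriv (p' \<kappa>)
       (\<lambda>x. symbol \<alpha> (\<sigma> * \<beta> / (1 + c * \<sigma>)) (\<mu> - \<sigma> * h) \<kappa> z * p \<kappa> x + (\<alpha> + \<i> * \<kappa>) * mode \<sigma> \<kappa> (f x))"
  shows "shifted_eq (linearization \<alpha> \<mu> h \<beta> c (\<sigma> *\<^sub>R e3)) z (\<lambda>x. of_mode \<sigma> 1 (p 1 x) + of_mode \<sigma> (- 1) (p (- 1) x)) f"
proof -
  define p'' where "p'' \<kappa> x = symbol \<alpha> (\<sigma> * \<beta> / (1 + c * \<sigma>)) (\<mu> - \<sigma> * h) \<kappa> z * p \<kappa> x + (\<alpha> + \<i> * \<kappa>) * mode \<sigma> \<kappa> (f x)" for \<kappa> x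
  have p'': "H1_deriv (p' \<kappa>) (p'' \<kappa>)" if "\<kappa> \<in> {1, -1}" for \<kappa>
    using p'[OF that] by (simp add: p''_def[abs_def])
  define assemble where "assemble q x = of_mode \<sigma> 1 (q 1 x) + of_mode \<sigma> (- 1) (q (- 1) x)" for q :: "complex \<Rightarrow> real \<Rightarrow> complex" and x
  define u where "u = assemble p"
  define g where "g x = z *s u x + f x" for x
  have mode_assemble: "mode \<sigma> \<kappa> (assemble q x) = q \<kappa> x" if "\<kappa> \<in> {1, -1}" for q \<kappa> x
    using that by (auto simp: assemble_def mode_linear mode_of_mode[OF \<sigma>])
  have L2p: "square_integrable (p \<kappa>)" "square_integrable (p' \<kappa>)" "square_integrable (p'' \<kappa>)" if "\<kappa> \<in> {1, -1}" for \<kappa>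
    using p[OF that] p''[OF that] by (auto simp: H1_deriv_def)
  have H: "H2_derivs u (assemble p') (assemble p'')"
    unfolding H2_derivs_def mem_L2_iff u_def assemble_def[abs_def]
    using L2p p p'' by (auto intro!: square_integrable_of_mode_pair of_mode_pair_primitive)
  have gL2: "g \<in> L2"
  proof -
    have bl: "bounded_linear (\<lambda>v::complex^2. z *s v)"
      unfolding linear_conv_bounded_linear[symmetric]
      by (rule linearI) (simp_all add: vec_eq_iff algebra_simps)
    have "square_integrable u" using H by (simp add: H2_derivs_def mem_L2_iff)
    then show ?thesis unfolding mem_L2_iff g_def[abs_def]
      using f by (intro square_integrable_add(1) square_integrable_bounded_linear(1)[OF _ bl]) (simp_all add: mem_L2_iff)
  qed
  have "linearized_eq_complex \<alpha> \<mu> h \<beta> c (\<sigma> *\<^sub>R e3) (u x) (g x) (assemble p'' x)" for x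
    unfolding linearized_eq_complex_iff_modes[OF c \<sigma>]
  proof
    fix \<kappa> :: complex assume \<kappa>: "\<kappa> \<in> {1, -1}"
    show "mode \<sigma> \<kappa> (assemble p'' x) = (\<alpha> + \<i> * \<kappa>) * mode \<sigma> \<kappa> (g x) -
       (\<i> * \<kappa> * complex_of_real (\<sigma> * \<beta> / (1 + c * \<sigma>)) + complex_of_real (\<mu> - \<sigma> * h)) * mode \<sigma> \<kappa> (u x)"
      unfolding g_def mode_linear u_def mode_assemble[OF \<kappa>] p''_def symbol_def
      by (simp add: algebra_simps)
  qed
  then have "(u, g) \<in> linearization \<alpha> \<mu> h \<beta> c (\<sigma> *\<^sub>R e3)"
    unfolding linearization_def using gL2 H by auto
  then have "shifted_eq (linearization \<alpha> \<mu> h \<beta> c (\<sigma> *\<^sub>R e3)) z u f"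
    unfolding shifted_eq_def by (intro exI[of _ g] conjI) (simp_all add: g_def)
  then show ?thesis by (simp add: u_def assemble_def[abs_def])
qed

section \<open>The spectrum of the linearization\<close>

text \<open>
  The principal square root has real part zero exactly on the nonpositive real axis.
\<close>

lemma complex_square_root_dichotomy:
  "(\<exists>l::real. K = - (of_real l)\<^sup>2) \<or> (\<exists>k. k\<^sup>2 = K \<and> Re k \<noteq> 0)" for K :: complex
proof (cases "Re (csqrt K) = 0")
  case True
  have "K = (csqrt K)\<^sup>2" by simp
  also have "csqrt K = \<i> * of_real (Im (csqrt K))" using True by (simp add: complex_eq_iff)
  finally have "K = - (of_real (Im (csqrt K)))\<^sup>2" by (simp add: power_mult_distrib)
  then show ?thesis by blast
qed (auto intro!: exI[of _ "csqrt K"])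

lemma shifted_eq_unique:
  fixes c \<sigma> :: real
  assumes c: "1 + c * \<sigma> \<noteq> 0" and \<sigma>: "\<sigma> = 1 \<or> \<sigma> = -1"
    and S: "shifted_eq (linearization \<alpha> \<mu> h \<beta> c (\<sigma> *\<^sub>R e3)) z u f"
      "shifted_eq (linearization \<alpha> \<mu> h \<beta> c (\<sigma> *\<^sub>R e3)) z v f"
  shows "u = v"
proof
  fix x
  have eq: "mode \<sigma> \<kappa> (u x - v x) = 0" if \<kappa>: "\<kappa> \<in> {1, -1}" for \<kappa>
  proof -
    define K where "K = symbol \<alpha> (\<sigma> * \<beta> / (1 + c * \<sigma>)) (\<mu> - \<sigma> * h) \<kappa> z"
    obtain u' u'' where u: "H1_deriv (\<lambda>x. mode \<sigma> \<kappa> (u x)) u'" "H1_deriv u' u''"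
      "AE x in lborel. u'' x = K * mode \<sigma> \<kappa> (u x) + (\<alpha> + \<i> * \<kappa>) * mode \<sigma> \<kappa> (f x)"
      using shifted_eq_modes(2)[OF c \<sigma> \<kappa> S(1)] by (auto simp: K_def)
    obtain v' v'' where v: "H1_deriv (\<lambda>x. mode \<sigma> \<kappa> (v x)) v'" "H1_deriv v' v''"
      "AE x in lborel. v'' x = K * mode \<sigma> \<kappa> (v x) + (\<alpha> + \<i> * \<kappa>) * mode \<sigma> \<kappa> (f x)"
      using shifted_eq_modes(2)[OF c \<sigma> \<kappa> S(2)] by (auto simp: K_def)
    have "AE x in lborel. u'' x + - 1 * v'' x = (csqrt K)\<^sup>2 * (mode \<sigma> \<kappa> (u x) + - 1 * mode \<sigma> \<kappa> (v x))"
      using u(3) v(3) by eventually_elim (simp add: algebra_simps)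
    from second_order_kernel_trivial[OF H1_deriv_add[OF u(1) H1_deriv_cmult[OF v(1)]]
        H1_deriv_add[OF u(2) H1_deriv_cmult[OF v(2)]] this]
    show ?thesis by (simp add: mode_linear)
  qed
  have "u x - v x = 0" using modes_determine[OF \<sigma>] eq by blast
  then show "u x = v x" by simp
qed

lemma shifted_eq_zero:
  fixes c \<sigma> :: real
  assumes c: "1 + c * \<sigma> \<noteq> 0" and \<sigma>: "\<sigma> = 1 \<or> \<sigma> = -1"
  shows "shifted_eq (linearization \<alpha> \<mu> h \<beta> c (\<sigma> *\<^sub>R e3)) z u (\<lambda>_. 0) \<longleftrightarrow> u = (\<lambda>_. 0)"
proof -
  have "H1_deriv (\<lambda>_. 0) (\<lambda>_. 0)" "(\<lambda>_. 0) \<in> L2"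
    by (auto simp: H1_deriv_def square_integrable_def mem_L2_iff)
  then have "shifted_eq (linearization \<alpha> \<mu> h \<beta> c (\<sigma> *\<^sub>R e3)) z (\<lambda>x. of_mode \<sigma> 1 0 + of_mode \<sigma> (- 1) 0) (\<lambda>_. 0)"
    by (intro shifted_eq_of_modes[OF c \<sigma>, where p = "\<lambda>_ _. 0" and p' = "\<lambda>_ _. 0"]) (auto simp: mode_linear)
  moreover have "of_mode \<sigma> \<kappa> 0 = 0" for \<kappa> by (simp add: of_mode_def vec_eq_iff forall_2)
  ultimately have "shifted_eq (linearization \<alpha> \<mu> h \<beta> c (\<sigma> *\<^sub>R e3)) z (\<lambda>_. 0) (\<lambda>_. 0)" by simp
  then show ?thesis using shifted_eq_unique[OF c \<sigma>] by blast
qed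

text \<open>
  Off the dispersion curve the symbols of both modes have square roots with nonzero real part. The two
  scalar solutions are then assembled into a vector profile.
\<close>

lemma shifted_eq_solvable:
  fixes c \<sigma> :: real
  assumes c: "1 + c * \<sigma> \<noteq> 0" and \<sigma>: "\<sigma> = 1 \<or> \<sigma> = -1"
    and z: "z \<notin> dispersion_curve \<alpha> (\<sigma> * \<beta> / (1 + c * \<sigma>)) (\<mu> - \<sigma> * h)"
  shows "\<exists>C. \<forall>f\<in>L2. \<exists>u. shifted_eq (linearization \<alpha> \<mu> h \<beta> c (\<sigma> *\<^sub>R e3)) z u f \<and> L2_norm u \<le> C * L2_norm f"
proof -
  define K where "K \<kappa> = symbol \<alpha> (\<sigma> * \<beta> / (1 + c * \<sigma>)) (\<mu> - \<sigma> * h) \<kappa> z" for \<kappa>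
  have "\<forall>\<kappa>\<in>{1, -1}. \<exists>k. k\<^sup>2 = K \<kappa> \<and> Re k \<noteq> 0"
    using complex_square_root_dichotomy z by (force simp: dispersion_curve_def K_def)
  then obtain k where k: "(k \<kappa>)\<^sup>2 = K \<kappa>" "Re (k \<kappa>) \<noteq> 0" if "\<kappa> \<in> {1, -1}" for \<kappa>
    by metis
  define T where "T \<kappa> = (\<lambda>v. (\<alpha> + \<i> * \<kappa>) * mode \<sigma> \<kappa> v)" for \<kappa>
  have T: "bounded_linear (T \<kappa>)" for \<kappa>
    unfolding T_def by (rule bounded_linear_compose[OF bounded_linear_mult_right bounded_linear_mode])
  define M where "M \<kappa> = (onorm (of_mode \<sigma> \<kappa>))\<^sup>2 * ((onorm (T \<kappa>))\<^sup>2 / (Re (k \<kappa>)) ^ 4)" for \<kappa>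
  define C where "C = 2 * M 1 + 2 * M (- 1)"
  show ?thesis
  proof (intro exI[of _ "sqrt C"] ballI)
    fix f :: profile assume f: "f \<in> L2"
    have Tf: "square_integrable (\<lambda>x. T \<kappa> (f x))" "L2_sq (\<lambda>x. T \<kappa> (f x)) \<le> (onorm (T \<kappa>))\<^sup>2 * L2_sq f" for \<kappa>
      using square_integrable_bounded_linear[OF _ T] f by (auto simp: mem_L2_iff)
    define G where "G \<kappa> p p' \<longleftrightarrow> H1_deriv p p' \<and> H1_deriv p' (\<lambda>x. K \<kappa> * p x + T \<kappa> (f x)) \<and>
        L2_sq p \<le> L2_sq (\<lambda>x. T \<kappa> (f x)) / (Re (k \<kappa>)) ^ 4" for \<kappa> p p'
    have "\<forall>\<kappa>\<in>{1, -1}. \<exists>p p'. G \<kappa> p p'"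
      using second_order_solvable[OF k(2) Tf(1)] k(1) by (simp add: G_def)
    then obtain p p' where "\<forall>\<kappa>\<in>{1, -1}. G \<kappa> (p \<kappa>) (p' \<kappa>)"
      by metis
    then have p: "H1_deriv (p \<kappa>) (p' \<kappa>)" "H1_deriv (p' \<kappa>) (\<lambda>x. K \<kappa> * p \<kappa> x + T \<kappa> (f x))"
        "L2_sq (p \<kappa>) \<le> L2_sq (\<lambda>x. T \<kappa> (f x)) / (Re (k \<kappa>)) ^ 4" if "\<kappa> \<in> {1, -1}" for \<kappa>
      using that unfolding G_def by blast+
    define u where "u x = of_mode \<sigma> 1 (p 1 x) + of_mode \<sigma> (- 1) (p (- 1) x)" for x
    have S: "shifted_eq (linearization \<alpha> \<mu> h \<beta> c (\<sigma> *\<^sub>R e3)) z u f"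
      unfolding u_def using shifted_eq_of_modes[OF c \<sigma> f, of p p'] p by (simp add: K_def T_def)
    have bound: "square_integrable (\<lambda>x. of_mode \<sigma> \<kappa> (p \<kappa> x))" "L2_sq (\<lambda>x. of_mode \<sigma> \<kappa> (p \<kappa> x)) \<le> M \<kappa> * L2_sq f"
      if \<kappa>: "\<kappa> \<in> {1, -1}" for \<kappa>
    proof -
      have sp: "square_integrable (p \<kappa>)" using p(1)[OF \<kappa>] by (simp add: H1_deriv_def)
      show "square_integrable (\<lambda>x. of_mode \<sigma> \<kappa> (p \<kappa> x))"
        by (rule square_integrable_bounded_linear(1)[OF sp bounded_linear_of_mode])
      have "L2_sq (\<lambda>x. of_mode \<sigma> \<kappa> (p \<kappa> x)) \<le> (onorm (of_mode \<sigma> \<kappa>))\<^sup>2 * L2_sq (p \<kappa>)"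
        by (rule square_integrable_bounded_linear(2)[OF sp bounded_linear_of_mode])
      also have "\<dots> \<le> (onorm (of_mode \<sigma> \<kappa>))\<^sup>2 * ((onorm (T \<kappa>))\<^sup>2 * L2_sq f / (Re (k \<kappa>)) ^ 4)"
        by (intro mult_left_mono order_trans[OF p(3)[OF \<kappa>]] divide_right_mono Tf(2)) auto
      finally show "L2_sq (\<lambda>x. of_mode \<sigma> \<kappa> (p \<kappa> x)) \<le> M \<kappa> * L2_sq f" by (simp add: M_def)
    qed
    have "L2_sq u \<le> 2 * L2_sq (\<lambda>x. of_mode \<sigma> 1 (p 1 x)) + 2 * L2_sq (\<lambda>x. of_mode \<sigma> (- 1) (p (- 1) x))"
      unfolding u_def by (rule square_integrable_add(2)) (use bound(1) in auto)
    also have "\<dots> \<le> C * L2_sq f"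
      using bound(2)[of 1] bound(2)[of "-1"] by (simp add: C_def algebra_simps)
    finally have "L2_norm u \<le> sqrt C * L2_norm f"
      unfolding L2_norm_eq real_sqrt_mult[symmetric] by (rule real_sqrt_le_mono)
    with S show "\<exists>u. shifted_eq (linearization \<alpha> \<mu> h \<beta> c (\<sigma> *\<^sub>R e3)) z u f \<and> L2_norm u \<le> sqrt C * L2_norm f" by blast
  qed
qed

text \<open>
  On the dispersion curve one of the scalar equations has symbol \<open>- l\<^sup>2\<close>. The resonant forcing of that
  mode cannot be matched by any \<open>L\<^sup>2\<close> solution.
\<close>

lemma shifted_eq_unsolvable:
  fixes c \<sigma> :: real
  assumes c: "1 + c * \<sigma> \<noteq> 0" and \<sigma>: "\<sigma> = 1 \<or> \<sigma> = -1" and \<alpha>: "\<alpha> > 0"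
    and z: "z \<in> dispersion_curve \<alpha> (\<sigma> * \<beta> / (1 + c * \<sigma>)) (\<mu> - \<sigma> * h)"
  shows "\<exists>f\<in>L2. \<nexists>u. shifted_eq (linearization \<alpha> \<mu> h \<beta> c (\<sigma> *\<^sub>R e3)) z u f"
proof -
  obtain \<kappa> l where \<kappa>: "\<kappa> \<in> {1, -1}"
    and l: "symbol \<alpha> (\<sigma> * \<beta> / (1 + c * \<sigma>)) (\<mu> - \<sigma> * h) \<kappa> z = - (complex_of_real l)\<^sup>2"
    using z by (auto simp: dispersion_curve_def)
  define a where "a = complex_of_real \<alpha> + \<i> * \<kappa>"
  have a: "a \<noteq> 0" using \<alpha> \<kappa> by (auto simp: a_def complex_eq_iff)
  define q where "q x = exp (- (\<i> * l) * x) * indicator {0..1} x / a" for x :: real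
  have q: "square_integrable q"
  proof -
    have "square_integrable (\<lambda>x::real. indicator {0..1} x :: complex)"
    proof -
      have "(norm (indicator {0..1} x :: complex))\<^sup>2 = indicator {0..1} x" for x :: real
        by (simp add: indicator_def)
      then show ?thesis by (simp add: square_integrable_def emeasure_lborel_Icc_eq)
    qed
    moreover have "q \<in> borel_measurable borel" unfolding q_def by measurable
    moreover have "norm (q x) \<le> (1 / norm a) * norm (indicator {0..1} x :: complex)" for x
      by (simp add: q_def norm_mult norm_divide)
    ultimately show ?thesis by (rule square_integrable_dominated(1))
  qed
  show ?thesis
  proof (intro bexI notI)
    show "(\<lambda>x. of_mode \<sigma> \<kappa> (q x)) \<in> L2"
      using square_integrable_bounded_linear(1)[OF q bounded_linear_of_mode] by (simp add: mem_L2_iff)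
    assume "\<exists>u. shifted_eq (linearization \<alpha> \<mu> h \<beta> c (\<sigma> *\<^sub>R e3)) z u (\<lambda>x. of_mode \<sigma> \<kappa> (q x))"
    then obtain u where "shifted_eq (linearization \<alpha> \<mu> h \<beta> c (\<sigma> *\<^sub>R e3)) z u (\<lambda>x. of_mode \<sigma> \<kappa> (q x))" by blast
    from shifted_eq_modes(2)[OF c \<sigma> \<kappa> this] obtain u' u'' where
      "H1_deriv (\<lambda>x. mode \<sigma> \<kappa> (u x)) u'" "H1_deriv u' u''"
      and "AE x in lborel. u'' x = - (complex_of_real l)\<^sup>2 * mode \<sigma> \<kappa> (u x) + a * q x"
      unfolding l a_def[symmetric] mode_of_mode[OF \<sigma> \<kappa> \<kappa>] by auto
    then show False
      using a by (intro second_order_unsolvable[of "\<lambda>x. mode \<sigma> \<kappa> (u x)" u' u'' l]) (simp_all add: q_def)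
  qed
qed

text \<open>
  When all profiles in question vanish almost everywhere, every choice of coefficients represents the
  zero class; uniqueness of coefficients then rules out any basis vector.
\<close>

lemma has_quotient_dim_L2_null_trivial:
  assumes "V \<subseteq> L2_null" "V \<noteq> {}" "has_quotient_dim V L2_null k"
  shows "k = 0"
proof (rule ccontr)
  assume "k \<noteq> 0"
  from assms(3) obtain e where e: "\<forall>i<k. e i \<in> V" and uniq: "\<forall>v\<in>V. \<exists>!a :: nat \<Rightarrow> complex. (\<forall>i\<ge>k. a i = 0) \<and>
            (\<lambda>x. v x - (\<Sum>i<k. a i *s e i x)) \<in> L2_null"
    unfolding has_quotient_dim_def by (elim exE conjE) (rule that)
  obtain v where v: "v \<in> V" using assms(2) by blast
  have null: "(\<lambda>x. v x - (\<Sum>i<k. a i *s e i x)) \<in> L2_null" for a :: "nat \<Rightarrow> complex"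
  proof -
    have meas: "v \<in> borel_measurable borel" "\<And>i. i < k \<Longrightarrow> e i \<in> borel_measurable borel"
      and AE: "AE x in lborel. v x = 0" "\<And>i. i < k \<Longrightarrow> AE x in lborel. e i x = 0"
      using v e assms(1) by (auto simp: L2_null_def L2_def)
    have ae: "AE x in lborel. v x - (\<Sum>i<k. a i *s e i x) = 0"
    proof -
      have "AE x in lborel. \<forall>i\<in>{..<k}. e i x = 0" using AE(2) by (intro AE_finite_allI) auto
      with AE(1) show ?thesis by eventually_elim simp
    qed
    have m: "(\<lambda>x. a i *s e i x) \<in> borel_measurable borel" if "i < k" for i
    proof -
      have "(\<lambda>w::complex^2. a i *s w) \<in> borel_measurable borel"
      proof (intro borel_measurable_continuous_onI linear_continuous_on)
        show "bounded_linear (\<lambda>w::complex^2. a i *s w)"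
          unfolding linear_conv_bounded_linear[symmetric]
          by (rule linearI) (simp_all add: vec_eq_iff algebra_simps)
      qed
      from measurable_compose[OF meas(2)[OF that] this] show ?thesis .
    qed
    have mv: "(\<lambda>x. v x - (\<Sum>i<k. a i *s e i x)) \<in> borel_measurable borel"
      using meas(1) m by (intro borel_measurable_diff borel_measurable_sum) auto
    have "square_integrable (\<lambda>_. 0 :: complex^2)" by (simp add: square_integrable_def)
    then have "square_integrable (\<lambda>x. v x - (\<Sum>i<k. a i *s e i x))"
      using square_integrable_AE_cong(2)[OF ae mv] by simp
    with ae show ?thesis by (simp add: L2_null_def mem_L2_iff)
  qed
  from bspec[OF uniq v] show False
  proof (elim ex1E)
    fix a assume a: "\<forall>b. (\<forall>i\<ge>k. b i = 0) \<and> (\<lambda>x. v x - (\<Sum>i<k. b i *s e i x)) \<in> L2_null \<longrightarrow> b = a"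
    have zero: "(\<lambda>_. 0) = a"
      by (rule a[rule_format, OF conjI[OF _ null]]) simp
    have unit: "(\<lambda>i. if i = 0 then 1 else 0) = a"
      by (rule a[rule_format, OF conjI[OF _ null]]) (use \<open>k \<noteq> 0\<close> in simp)
    show False using fun_cong[OF trans[OF zero unit[symmetric]], of 0] by simp
  qed
qed

text \<open>
  The kernel is always trivial, so index zero forces the range to have codimension zero. The resolvent set
  and the set where \<open>T - z\<close> is Fredholm of index zero are therefore both the set where \<open>T - z\<close> is onto.
\<close>

lemma spectrum_linearization:
  fixes c \<sigma> :: real
  assumes c: "1 + c * \<sigma> \<noteq> 0" and \<sigma>: "\<sigma> = 1 \<or> \<sigma> = -1" and \<alpha>: "\<alpha> > 0"
  shows "spectrum (linearization \<alpha> \<mu> h \<beta> c (\<sigma> *\<^sub>R e3)) = dispersion_curve \<alpha> (\<sigma> * \<beta> / (1 + c * \<sigma>)) (\<mu> - \<sigma> * h)"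
      (is "spectrum ?T = ?D")
    and "essential_spectrum (linearization \<alpha> \<mu> h \<beta> c (\<sigma> *\<^sub>R e3)) = dispersion_curve \<alpha> (\<sigma> * \<beta> / (1 + c * \<sigma>)) (\<mu> - \<sigma> * h)"
proof -
  have ker: "shifted_kernel ?T z = {\<lambda>_. 0}" for z
    unfolding shifted_kernel_def using shifted_eq_zero[OF c \<sigma>] by auto
  have null0: "(\<lambda>_. 0) \<in> L2_null" by (simp add: L2_null_def mem_L2_iff square_integrable_def)
  have res: "z \<in> resolvent_set ?T" if z: "z \<notin> ?D" for z
  proof -
    obtain C where C: "\<forall>f\<in>L2. \<exists>u. shifted_eq ?T z u f \<and> L2_norm u \<le> C * L2_norm f"
      using shifted_eq_solvable[OF c \<sigma> z] by blast
    then have "L2_norm u \<le> C * L2_norm f" if "f \<in> L2" "shifted_eq ?T z u f" for f u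
      using shifted_eq_unique[OF c \<sigma>] that by metis
    moreover have "AE x in lborel. u x = 0" if "shifted_eq ?T z u (\<lambda>_. 0)" for u
      using that unfolding shifted_eq_zero[OF c \<sigma>] by simp
    ultimately show ?thesis
      unfolding resolvent_set_def mem_Collect_eq using C by (intro conjI exI[of _ C]) blast+
  qed
  have res_onto: "\<forall>f\<in>L2. \<exists>u. shifted_eq ?T z u f" if "z \<in> resolvent_set ?T" for z
    using that unfolding resolvent_set_def mem_Collect_eq by (rule conjunct1)
  have onto: "(\<forall>f\<in>L2. \<exists>u. shifted_eq ?T z u f) \<longleftrightarrow> z \<notin> ?D" for z
    using shifted_eq_unsolvable[OF c \<sigma> \<alpha>] res_onto[OF res] by blast
  show "spectrum ?T = ?D"
    unfolding spectrum_def using onto res res_onto by blast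
  have "fredholm_index_zero ?T z \<longleftrightarrow> z \<notin> ?D" for z
  proof
    assume "z \<notin> ?D"
    then have range: "shifted_range ?T z = L2" using onto unfolding shifted_range_def by blast
    have "has_quotient_dim V W 0" if "V \<subseteq> W" for V W
      unfolding has_quotient_dim_def using that by auto
    then show "fredholm_index_zero ?T z"
      unfolding fredholm_index_zero_def range closed_in_L2_def ker using null0 by blast
  next
    assume "fredholm_index_zero ?T z"
    then obtain k where k: "has_quotient_dim {\<lambda>_. 0} L2_null k" "has_quotient_dim L2 (shifted_range ?T z) k"
      unfolding fredholm_index_zero_def ker by blast
    have "k = 0" using has_quotient_dim_L2_null_trivial[OF _ _ k(1)] null0 by blast
    then have "L2 \<subseteq> shifted_range ?T z" using k(2) by (auto simp: has_quotient_dim_def)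
    then show "z \<notin> ?D" using onto unfolding shifted_range_def by blast
  qed
  then show "essential_spectrum ?T = ?D" unfolding essential_spectrum_def by auto
qed

text \<open>
  The phase \<open>e\<^bsup>i l x\<^esup>\<close> never vanishes and cancels; what is left holds for some nonzero vector iff one of the
  two diagonal entries vanishes.
\<close>

lemma fourier_mode_iff:
  fixes c \<sigma> :: real
  assumes c: "1 + c * \<sigma> \<noteq> 0" and \<sigma>: "\<sigma> = 1 \<or> \<sigma> = -1"
  shows "fourier_mode \<alpha> \<mu> h \<beta> c (\<sigma> *\<^sub>R e3) z l \<longleftrightarrow>
    (\<exists>\<kappa>\<in>{1, -1}. symbol \<alpha> (\<sigma> * \<beta> / (1 + c * \<sigma>)) (\<mu> - \<sigma> * h) \<kappa> z = - (complex_of_real l)\<^sup>2)"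
    (is "_ \<longleftrightarrow> (\<exists>\<kappa>\<in>_. ?R \<kappa>)")
proof -
  have vd: "vector_derivative (\<lambda>x. (w * cis (l * x)) *s v) (at x) = (\<i> * l * w * cis (l * x)) *s v"
    for w and v :: "complex^2" and x
  proof -
    have "((\<lambda>x. w * exp (\<i> * l * complex_of_real x)) has_vector_derivative (\<i> * l * w * exp (\<i> * l * x))) (at x)"
      by (rule has_vector_derivative_real_field) (auto intro!: derivative_eq_intros)
    then have "((\<lambda>x. w * cis (l * x)) has_vector_derivative (\<i> * l * w * cis (l * x))) (at x)"
      by (simp add: cis_conv_exp mult.assoc)
    moreover have "bounded_linear (\<lambda>y. y *s v)"
      unfolding linear_conv_bounded_linear[symmetric]
      by (rule linearI) (simp_all add: vec_eq_iff algebra_simps)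
    ultimately have "((\<lambda>x. (w * cis (l * x)) *s v) has_vector_derivative (\<i> * l * w * cis (l * x)) *s v) (at x)"
      using bounded_linear.has_vector_derivative by blast
    then show ?thesis by (rule vector_derivative_at)
  qed
  have vd1: "vector_derivative (\<lambda>x. cis (l * x) *s v) (at x) = (\<i> * l * cis (l * x)) *s v" for v :: "complex^2" and x
    using vd[of 1] by simp
  have modes: "(\<forall>x. linearized_eq_complex \<alpha> \<mu> h \<beta> c (\<sigma> *\<^sub>R e3) (cis (l * x) *s v) (z *s (cis (l * x) *s v)) ((\<i> * l * (\<i> * l) * cis (l * x)) *s v))
     \<longleftrightarrow> (\<forall>\<kappa>\<in>{1, -1}. mode \<sigma> \<kappa> v = 0 \<or> symbol \<alpha> (\<sigma> * \<beta> / (1 + c * \<sigma>)) (\<mu> - \<sigma> * h) \<kappa> z = - (complex_of_real l)\<^sup>2)" for v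
  proof -
    have cancel_phase: "(\<i> * l * (\<i> * l) * w) * m = (\<alpha> + \<i> * \<kappa>) * (z * (w * m)) - (\<i> * \<kappa> * B + d) * (w * m) \<longleftrightarrow>
      m = 0 \<or> (\<alpha> + \<i> * \<kappa>) * z - (\<i> * \<kappa> * B + d) = - (complex_of_real l)\<^sup>2" if "w \<noteq> 0" for w m \<kappa> B d :: complex
    proof -
      have "(\<i> * l * (\<i> * l) * w) * m = (\<alpha> + \<i> * \<kappa>) * (z * (w * m)) - (\<i> * \<kappa> * B + d) * (w * m) \<longleftrightarrow>
        (w * m) * (((\<alpha> + \<i> * \<kappa>) * z - (\<i> * \<kappa> * B + d)) - - (complex_of_real l)\<^sup>2) = 0"
        by (auto simp: power2_eq_square algebra_simps)
      then show ?thesis using that by (simp add: eq_neg_iff_add_eq_0)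
    qed
    show ?thesis
      unfolding linearized_eq_complex_iff_modes[OF c \<sigma>] mode_linear symbol_def
        cancel_phase[OF cis_neq_zero] by (simp only: simp_thms)
  qed
  have ex: "\<exists>v. v \<noteq> 0 \<and> (\<forall>\<kappa>'\<in>{1, -1}. mode \<sigma> \<kappa>' v = 0 \<or> \<kappa>' = \<kappa>)" if \<kappa>: "\<kappa> \<in> {1, -1}" for \<kappa>
  proof (intro exI[of _ "of_mode \<sigma> \<kappa> 1"] conjI)
    show "of_mode \<sigma> \<kappa> 1 \<noteq> 0" using mode_of_mode[OF \<sigma> \<kappa> \<kappa>, of 1] by (auto simp: mode_linear)
    show "\<forall>\<kappa>'\<in>{1, -1}. mode \<sigma> \<kappa>' (of_mode \<sigma> \<kappa> 1) = 0 \<or> \<kappa>' = \<kappa>"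
      using mode_of_mode[OF \<sigma> \<kappa>] by simp
  qed
  show ?thesis
    unfolding fourier_mode_def Let_def vd1 vd modes
  proof
    assume "\<exists>v. v \<noteq> 0 \<and> (\<forall>\<kappa>\<in>{1, -1}. mode \<sigma> \<kappa> v = 0 \<or> ?R \<kappa>)"
    then obtain v where v: "v \<noteq> 0" "mode \<sigma> 1 v = 0 \<or> ?R 1" "mode \<sigma> (- 1) v = 0 \<or> ?R (- 1)" by auto
    show "\<exists>\<kappa>\<in>{1, -1}. ?R \<kappa>"
    proof (rule ccontr)
      assume "\<not> ?thesis"
      then have "\<not> ?R 1" "\<not> ?R (- 1)" by blast+
      then show False using v modes_determine[OF \<sigma>, of v] by simp
    qed
  next
    assume "\<exists>\<kappa>\<in>{1, -1}. ?R \<kappa>"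
    then obtain \<kappa> where \<kappa>: "\<kappa> \<in> {1, -1}" "?R \<kappa>" by blast
    then show "\<exists>v. v \<noteq> 0 \<and> (\<forall>\<kappa>\<in>{1, -1}. mode \<sigma> \<kappa> v = 0 \<or> ?R \<kappa>)"
      using ex[OF \<kappa>(1)] by metis
  qed
qed

section \<open>Stability thresholds\<close>

text \<open>
  The real and imaginary parts of \<open>(\<alpha> + i \<kappa>) z - i \<kappa> B - d = - l\<^sup>2\<close>, solved for \<open>z\<close>.
\<close>

lemma symbol_eq_iff:
  assumes "\<kappa> = 1 \<or> \<kappa> = -1"
  assumes \<alpha>: "\<alpha> > 0"
  shows "symbol \<alpha> B d (complex_of_real \<kappa>) z = - (complex_of_real l)\<^sup>2 \<longleftrightarrow>
    Re z = (\<alpha> * (d - l\<^sup>2) + B) / (1 + \<alpha>\<^sup>2) \<and> Im z = \<kappa> * (B - Re z) / \<alpha>"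
proof -
  have p: "1 + \<alpha>\<^sup>2 > 0" by (simp add: add_pos_nonneg)
  have "symbol \<alpha> B d (complex_of_real \<kappa>) z = - (complex_of_real l)\<^sup>2 \<longleftrightarrow>
    \<alpha> * Re z - \<kappa> * Im z - d = - l\<^sup>2 \<and> \<alpha> * Im z + \<kappa> * Re z - \<kappa> * B = 0"
    by (simp add: symbol_def complex_eq_iff power2_eq_square algebra_simps)
  also have "\<dots> \<longleftrightarrow> \<alpha> * Re z - \<kappa> * Im z - d = - l\<^sup>2 \<and> Im z = \<kappa> * (B - Re z) / \<alpha>"
    using \<alpha> by (auto simp: field_simps)
  also have "\<dots> \<longleftrightarrow> Re z = (\<alpha> * (d - l\<^sup>2) + B) / (1 + \<alpha>\<^sup>2) \<and> Im z = \<kappa> * (B - Re z) / \<alpha>"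
  proof -
    have "\<alpha> * Re z - \<kappa> * Im z - d = - l\<^sup>2 \<longleftrightarrow> Re z = (\<alpha> * (d - l\<^sup>2) + B) / (1 + \<alpha>\<^sup>2)"
      if im: "Im z = \<kappa> * (B - Re z) / \<alpha>"
    proof -
      have "\<kappa> * Im z = (B - Re z) / \<alpha>" using assms(1) by (auto simp: im)
      then have "\<alpha> * Re z - \<kappa> * Im z - d = - l\<^sup>2 \<longleftrightarrow> \<alpha> * (\<alpha> * Re z - (B - Re z) / \<alpha>) = \<alpha> * (d - l\<^sup>2)"
        using \<alpha> by auto
      also have "\<dots> \<longleftrightarrow> Re z * (1 + \<alpha>\<^sup>2) = \<alpha> * (d - l\<^sup>2) + B"
      proof -
        have "\<alpha> * (\<alpha> * Re z - (B - Re z) / \<alpha>) = Re z * (1 + \<alpha>\<^sup>2) - B"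
          using \<alpha> by (simp add: field_simps power2_eq_square)
        then show ?thesis by linarith
      qed
      finally show ?thesis using p by (simp add: eq_divide_eq)
    qed
    then show ?thesis by blast
  qed
  finally show ?thesis .
qed

lemma mem_dispersion_curve_iff:
  assumes \<alpha>: "\<alpha> > 0"
  shows "z \<in> dispersion_curve \<alpha> B d \<longleftrightarrow> (\<exists>l. Re z = (\<alpha> * (d - l\<^sup>2) + B) / (1 + \<alpha>\<^sup>2)) \<and>
    (Im z = (B - Re z) / \<alpha> \<or> Im z = - (B - Re z) / \<alpha>)"
  unfolding dispersion_curve_def using symbol_eq_iff[of 1, OF _ \<alpha>] symbol_eq_iff[of "-1", OF _ \<alpha>] by auto

lemma dispersion_curve_Re_le:
  assumes \<alpha>: "\<alpha> > 0" and z: "z \<in> dispersion_curve \<alpha> B d"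
  shows "Re z \<le> (\<alpha> * d + B) / (1 + \<alpha>\<^sup>2)"
proof -
  obtain l where l: "Re z = (\<alpha> * (d - l\<^sup>2) + B) / (1 + \<alpha>\<^sup>2)" using z mem_dispersion_curve_iff[OF \<alpha>] by blast
  have "\<alpha> * (d - l\<^sup>2) \<le> \<alpha> * d" using \<alpha> by (intro mult_left_mono) auto
  then show ?thesis unfolding l by (intro divide_right_mono) (auto simp: add_nonneg_nonneg)
qed

lemma dispersion_curve_Re_attained:
  assumes \<alpha>: "\<alpha> > 0"
  obtains z where "z \<in> dispersion_curve \<alpha> B d" "Re z = (\<alpha> * d + B) / (1 + \<alpha>\<^sup>2)"
proof
  define r where "r = (\<alpha> * d + B) / (1 + \<alpha>\<^sup>2)"
  show "Complex r ((B - r) / \<alpha>) \<in> dispersion_curve \<alpha> B d"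
    unfolding mem_dispersion_curve_iff[OF \<alpha>] by (auto simp: r_def intro!: exI[of _ 0])
  show "Re (Complex r ((B - r) / \<alpha>)) = (\<alpha> * d + B) / (1 + \<alpha>\<^sup>2)" by (simp add: r_def)
qed

text \<open>
  The largest real part in the spectrum is \<open>(\<alpha> d + B) / (1 + \<alpha>\<^sup>2)\<close>, and it is attained, namely by the
  homogeneous mode \<open>l = 0\<close>.
\<close>

lemma stability_iff_growth_rate:
  fixes c \<sigma> :: real
  assumes c: "1 + c * \<sigma> \<noteq> 0" and \<sigma>: "\<sigma> = 1 \<or> \<sigma> = -1" and \<alpha>: "\<alpha> > 0"
  shows "strictly_stable \<alpha> \<mu> h \<beta> c (\<sigma> *\<^sub>R e3) \<longleftrightarrow> \<alpha> * (\<mu> - \<sigma> * h) + \<sigma> * \<beta> / (1 + c * \<sigma>) < 0"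
    and "unstable \<alpha> \<mu> h \<beta> c (\<sigma> *\<^sub>R e3) \<longleftrightarrow> \<alpha> * (\<mu> - \<sigma> * h) + \<sigma> * \<beta> / (1 + c * \<sigma>) > 0"
proof -
  define d where "d = \<mu> - \<sigma> * h"
  define B where "B = \<sigma> * \<beta> / (1 + c * \<sigma>)"
  have p: "1 + \<alpha>\<^sup>2 > 0" by (simp add: add_pos_nonneg)
  obtain z0 where z0: "z0 \<in> dispersion_curve \<alpha> B d" "Re z0 = (\<alpha> * d + B) / (1 + \<alpha>\<^sup>2)"
    by (rule dispersion_curve_Re_attained[OF \<alpha>])
  have le: "Re z \<le> (\<alpha> * d + B) / (1 + \<alpha>\<^sup>2)" if "z \<in> dispersion_curve \<alpha> B d" for z
    by (rule dispersion_curve_Re_le[OF \<alpha> that])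
  note spec = spectrum_linearization(1)[OF c \<sigma> \<alpha>, of \<mu> h \<beta>, folded B_def d_def]
  have "strictly_stable \<alpha> \<mu> h \<beta> c (\<sigma> *\<^sub>R e3) \<longleftrightarrow> (\<alpha> * d + B) / (1 + \<alpha>\<^sup>2) < 0"
    unfolding strictly_stable_def spec
  proof
    assume "\<exists>\<epsilon>>0. \<forall>z\<in>dispersion_curve \<alpha> B d. Re z \<le> - \<epsilon>"
    then show "(\<alpha> * d + B) / (1 + \<alpha>\<^sup>2) < 0" using z0 by fastforce
  next
    assume "(\<alpha> * d + B) / (1 + \<alpha>\<^sup>2) < 0"
    then show "\<exists>\<epsilon>>0. \<forall>z\<in>dispersion_curve \<alpha> B d. Re z \<le> - \<epsilon>"
      using le by (intro exI[of _ "- ((\<alpha> * d + B) / (1 + \<alpha>\<^sup>2))"]) auto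
  qed
  then show "strictly_stable \<alpha> \<mu> h \<beta> c (\<sigma> *\<^sub>R e3) \<longleftrightarrow> \<alpha> * (\<mu> - \<sigma> * h) + \<sigma> * \<beta> / (1 + c * \<sigma>) < 0"
    using p by (simp add: divide_less_0_iff B_def d_def)
  have "unstable \<alpha> \<mu> h \<beta> c (\<sigma> *\<^sub>R e3) \<longleftrightarrow> (\<alpha> * d + B) / (1 + \<alpha>\<^sup>2) > 0"
    unfolding unstable_def spec using z0 le by (metis less_le_trans)
  then show "unstable \<alpha> \<mu> h \<beta> c (\<sigma> *\<^sub>R e3) \<longleftrightarrow> \<alpha> * (\<mu> - \<sigma> * h) + \<sigma> * \<beta> / (1 + c * \<sigma>) > 0"
    using p by (simp add: zero_less_divide_iff B_def d_def)
qed

text \<open>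
  At the threshold \<open>\<alpha> d = - B\<close>, so \<open>Re z = - \<alpha> l\<^sup>2 / (1 + \<alpha>\<^sup>2)\<close>: the spectrum meets the imaginary axis only
  for \<open>l = 0\<close>, at \<open>Im z = \<plusminus> B / \<alpha>\<close>. The frequency is stated as \<open>\<sigma> B / \<alpha>\<close> because
  \<open>\<sigma> B = \<beta> / (1 + c \<sigma>)\<close>.
\<close>

lemma hopf_type_instability_at_threshold:
  fixes c \<sigma> \<beta> :: real
  assumes c: "1 + c * \<sigma> \<noteq> 0" and \<sigma>: "\<sigma> = 1 \<or> \<sigma> = -1" and \<alpha>: "\<alpha> > 0"
  defines "B \<equiv> \<sigma> * \<beta> / (1 + c * \<sigma>)"
  shows "hopf_type_instability \<alpha> h \<beta> c (\<sigma> *\<^sub>R e3) (\<sigma> * h - B / \<alpha>) (\<sigma> * B / \<alpha>)"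
proof -
  define d where "d = (\<sigma> * h - B / \<alpha>) - \<sigma> * h"
  have p: "1 + \<alpha>\<^sup>2 > 0" by (simp add: add_pos_nonneg)
  have d: "\<alpha> * d = - B" using \<alpha> by (simp add: d_def)
  have Re: "(\<alpha> * (d - l\<^sup>2) + B) / (1 + \<alpha>\<^sup>2) = - (\<alpha> * l\<^sup>2) / (1 + \<alpha>\<^sup>2)" for l
    using d by (simp add: right_diff_distrib)
  have Re0: "- (\<alpha> * l\<^sup>2) / (1 + \<alpha>\<^sup>2) = 0 \<longleftrightarrow> l = 0" for l
    using \<alpha> p by auto
  note spec = spectrum_linearization[OF c \<sigma> \<alpha>, of "\<sigma> * h - B / \<alpha>" h \<beta>, folded B_def, folded d_def]
  have freq: "{\<i> * complex_of_real (\<sigma> * B / \<alpha>), - \<i> * complex_of_real (\<sigma> * B / \<alpha>)}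
      = {z. Re z = 0 \<and> (Im z = B / \<alpha> \<or> Im z = - B / \<alpha>)}"
    using \<sigma> by (auto simp: complex_eq_iff)
  have mode: "fourier_mode \<alpha> (\<sigma> * h - B / \<alpha>) h \<beta> c (\<sigma> *\<^sub>R e3) z l \<and> Re z = 0 \<longleftrightarrow>
      l = 0 \<and> z \<in> {\<i> * complex_of_real (\<sigma> * B / \<alpha>), - \<i> * complex_of_real (\<sigma> * B / \<alpha>)}" for z l
    unfolding fourier_mode_iff[OF c \<sigma>] B_def[symmetric] d_def[symmetric] freq
    using symbol_eq_iff[of 1 \<alpha> B d z l] symbol_eq_iff[of "-1" \<alpha> B d z l] \<alpha> Re[of l] Re0[of l] Re0[of 0]
    by auto
  show ?thesis
    unfolding hopf_type_instability_def
  proof (intro conjI allI impI ballI)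
    fix \<mu> assume "\<mu> < \<sigma> * h - B / \<alpha>"
    then have "\<alpha> * (\<mu> - \<sigma> * h) < \<alpha> * (- B / \<alpha>)" using \<alpha> by (intro mult_strict_left_mono) auto
    then show "strictly_stable \<alpha> \<mu> h \<beta> c (\<sigma> *\<^sub>R e3)"
      unfolding stability_iff_growth_rate(1)[OF c \<sigma> \<alpha>] B_def[symmetric] using \<alpha> by simp
  next
    fix \<mu> assume "\<mu> > \<sigma> * h - B / \<alpha>"
    then have "\<alpha> * (\<mu> - \<sigma> * h) > \<alpha> * (- B / \<alpha>)" using \<alpha> by (intro mult_strict_left_mono) auto
    then show "unstable \<alpha> \<mu> h \<beta> c (\<sigma> *\<^sub>R e3)"
      unfolding stability_iff_growth_rate(2)[OF c \<sigma> \<alpha>] B_def[symmetric] using \<alpha> by simp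
  next
    fix z assume "z \<in> spectrum (linearization \<alpha> (\<sigma> * h - B / \<alpha>) h \<beta> c (\<sigma> *\<^sub>R e3))"
    then show "Re z \<le> 0" unfolding spec using dispersion_curve_Re_le[OF \<alpha>] d by fastforce
  next
    have "z \<in> dispersion_curve \<alpha> B d \<and> Re z = 0 \<longleftrightarrow> Re z = 0 \<and> (Im z = B / \<alpha> \<or> Im z = - B / \<alpha>)" for z
      unfolding mem_dispersion_curve_iff[OF \<alpha>] Re using Re0[of 0] by (auto intro!: exI[of _ 0])
    then show "spectrum (linearization \<alpha> (\<sigma> * h - B / \<alpha>) h \<beta> c (\<sigma> *\<^sub>R e3)) \<inter> {z. Re z = 0}
        = {\<i> * complex_of_real (\<sigma> * B / \<alpha>), - \<i> * complex_of_real (\<sigma> * B / \<alpha>)}"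
      unfolding spec freq by auto
  next
    show "essential_spectrum (linearization \<alpha> (\<sigma> * h - B / \<alpha>) h \<beta> c (\<sigma> *\<^sub>R e3))
        = spectrum (linearization \<alpha> (\<sigma> * h - B / \<alpha>) h \<beta> c (\<sigma> *\<^sub>R e3))"
      unfolding spec ..
  next
    show "{(z, l). Re z = 0 \<and> fourier_mode \<alpha> (\<sigma> * h - B / \<alpha>) h \<beta> c (\<sigma> *\<^sub>R e3) z l}
        = {(\<i> * complex_of_real (\<sigma> * B / \<alpha>), 0), (- \<i> * complex_of_real (\<sigma> * B / \<alpha>), 0)}"
      using mode by blast
  qed
qed

theorem lemma1:
  fixes \<alpha> \<mu> h \<beta> c :: real
  assumes "\<alpha> > 0" and "- 1 < c" and "c < 1"
  shows "(strictly_stable \<alpha> \<mu> h \<beta> c e3 \<longleftrightarrow> \<mu> < mu_plus \<alpha> h \<beta> c) \<and>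
    (strictly_stable \<alpha> \<mu> h \<beta> c (- e3) \<longleftrightarrow> \<mu> < mu_minus \<alpha> h \<beta> c) \<and>
    hopf_type_instability \<alpha> h \<beta> c e3 (mu_plus \<alpha> h \<beta> c) (beta_plus \<beta> c / \<alpha>) \<and>
    hopf_type_instability \<alpha> h \<beta> c (- e3) (mu_minus \<alpha> h \<beta> c) (beta_minus \<beta> c / \<alpha>) \<and>
    (c = 0 \<longrightarrow>
      (subsubcritical \<alpha> \<mu> h \<beta> c \<longleftrightarrow> - \<mu> > \<bar>h - \<beta> / \<alpha>\<bar>) \<and>
      (supercritical \<alpha> \<mu> h \<beta> c \<longleftrightarrow> \<mu> > \<bar>h - \<beta> / \<alpha>\<bar>))"
proof -
  have c: "1 + c * 1 \<noteq> 0" "1 + c * - 1 \<noteq> 0" using assms by auto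
  have \<sigma>: "(1::real) = 1 \<or> (1::real) = - 1" "(- 1::real) = 1 \<or> (- 1::real) = - 1" by auto
  have growth: "\<alpha> * y + B < 0 \<longleftrightarrow> y < - B / \<alpha>" "0 < \<alpha> * y + B \<longleftrightarrow> - B / \<alpha> < y" for y B
    using assms(1) by (auto simp: field_simps)
  note stab = stability_iff_growth_rate[OF _ _ assms(1), of c, unfolded growth]
  have plus: "strictly_stable \<alpha> \<mu> h \<beta> c e3 \<longleftrightarrow> \<mu> < mu_plus \<alpha> h \<beta> c"
      "unstable \<alpha> \<mu> h \<beta> c e3 \<longleftrightarrow> mu_plus \<alpha> h \<beta> c < \<mu>"
    using stab[OF c(1) \<sigma>(1), of \<mu> h \<beta>] by (auto simp: mu_plus_def beta_plus_def algebra_simps)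
  have minus: "strictly_stable \<alpha> \<mu> h \<beta> c (- e3) \<longleftrightarrow> \<mu> < mu_minus \<alpha> h \<beta> c"
      "unstable \<alpha> \<mu> h \<beta> c (- e3) \<longleftrightarrow> mu_minus \<alpha> h \<beta> c < \<mu>"
    using stab[OF c(2) \<sigma>(2), of \<mu> h \<beta>] by (auto simp: mu_minus_def beta_minus_def algebra_simps)
  have hopf_plus: "hopf_type_instability \<alpha> h \<beta> c e3 (mu_plus \<alpha> h \<beta> c) (beta_plus \<beta> c / \<alpha>)"
    using hopf_type_instability_at_threshold[OF c(1) \<sigma>(1) assms(1), of h \<beta>]
    by (simp add: mu_plus_def beta_plus_def)
  have hopf_minus: "hopf_type_instability \<alpha> h \<beta> c (- e3) (mu_minus \<alpha> h \<beta> c) (beta_minus \<beta> c / \<alpha>)"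
    using hopf_type_instability_at_threshold[OF c(2) \<sigma>(2) assms(1), of h \<beta>]
    by (simp add: mu_minus_def beta_minus_def)
  have "subsubcritical \<alpha> \<mu> h \<beta> c \<longleftrightarrow> - \<mu> > \<bar>h - \<beta> / \<alpha>\<bar>"
    "supercritical \<alpha> \<mu> h \<beta> c \<longleftrightarrow> \<mu> > \<bar>h - \<beta> / \<alpha>\<bar>" if "c = 0"
    using plus minus that
    by (auto simp: subsubcritical_def supercritical_def mu_plus_def mu_minus_def beta_plus_def beta_minus_def)
  with plus minus hopf_plus hopf_minus show ?thesis by blast
qed

end
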